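(* Let $x \in \mathbb{R}^d$ be an input vector and let $\gamma \in \mathbb{N}_+$ be the maximal number of bits needed to store any coefficient of the input. Then there is an algorithm that computes a vector $\hat x \in \arg\min_{x' \in \mathbb{R}^d : \mathrm{supp}(x') \in \mathbb{M}_{k,\Delta}} \|x - x'\|$ and runs in time $O(d(\gamma + \log k)\log d \log \Delta)$.
   Context: Notation: $[d] = \{1,\dots,d\}$, $\mathrm{supp}(\theta) = \{i : \theta_i \neq 0\}$, $\|\cdot\|$ is the $\ell_2$-norm, $k,\Delta$ are positive integers. For $\Omega \subseteq [d]$ let $\mathrm{sep}(\Omega) = \min_{i \neq j \in \Omega}|i-j|$, $\mathbb{M}_\Delta = \{\Omega \subseteq [d] : \mathrm{sep}(\Omega) \ge \Delta\}$ and $\mathbb{M}_{k,\Delta} = \{\Omega \in \mathbb{M}_\Delta : |\Omega| = k\}$.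
   Formalization: The argmin can be empty (e.g. x = 0, or no set in M_{k,Δ}), so x̂ is claimed to lie in it only when it is nonempty; x̂ is also optimal when supp(x') need only lie inside a set of M_{k,Δ}. log d and log Δ are read as at least 1; coefficients share a fixed-point format. *)

theory Defs
  imports "HOL-Analysis.L2_Norm" "HOL-Library.Extended_Nat"
begin

text \<open>
  Vectors in \<open>\<real>\<^sup>d\<close> are functions on \<open>nat\<close> of which only the coordinates \<open>1, \<dots>, d\<close> matter;
  \<open>d\<close> has to be an ordinary variable because one program must work for all dimensions.
\<close>

definition supp :: "nat \<Rightarrow> (nat \<Rightarrow> real) \<Rightarrow> nat set" where
  "supp d \<theta> = {i \<in> {1..d}. \<theta> i \<noteq> 0}"

definition l2_dist :: "nat \<Rightarrow> (nat \<Rightarrow> real) \<Rightarrow> (nat \<Rightarrow> real) \<Rightarrow> real" where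
  "l2_dist d x y = L2_set (\<lambda>i. x i - y i) {1..d}"

text \<open>The minimum over the empty set is \<open>\<infinity>\<close>, so sets with at most one element are separated.\<close>

definition sep :: "nat set \<Rightarrow> enat" where
  "sep \<Omega> = (INF (i, j) \<in> {(i, j). i \<in> \<Omega> \<and> j \<in> \<Omega> \<and> i \<noteq> j}. enat (nat \<bar>int i - int j\<bar>))"

definition sep_sets :: "nat \<Rightarrow> nat \<Rightarrow> nat set set" where
  "sep_sets d \<Delta> = {\<Omega>. \<Omega> \<subseteq> {1..d} \<and> sep \<Omega> \<ge> enat \<Delta>}"

definition sep_sets_card :: "nat \<Rightarrow> nat \<Rightarrow> nat \<Rightarrow> nat set set" where
  "sep_sets_card d k \<Delta> = {\<Omega> \<in> sep_sets d \<Delta>. card \<Omega> = k}"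


subsection \<open>Word RAM programs\<close>

text \<open>
  Algorithms are programs of a small imperative language with integer variables and integer
  arrays. Every operation has unit cost, but every value occurring in an evaluation must fit
  into a machine word of \<open>w\<close> bits (plus a sign); otherwise, or on a negative array index or a
  division by zero, the program is stuck. Without the word bound, unit-cost multiplication
  would make the model unrealistically powerful.
\<close>

type_synonym vname = string

datatype aexp =
    Const int
  | Var vname
  | Elem vname aexp
  | Add aexp aexp
  | Sub aexp aexp
  | Mul aexp aexp
  | Div aexp aexp

datatype bexp = Less aexp aexp | Neg bexp | And bexp bexp

datatype com =
    Skip
  | Assign vname aexp
  | Store vname aexp aexp
  | Seq com com
  | Cond bexp com com
  | While bexp com

record state =
  vars :: "vname \<Rightarrow> int"
  arrs :: "vname \<Rightarrow> nat \<Rightarrow> int"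

definition word :: "nat \<Rightarrow> int \<Rightarrow> int option" where
  "word w v = (if \<bar>v\<bar> < 2 ^ w then Some v else None)"

definition word_op :: "nat \<Rightarrow> (int \<Rightarrow> int \<Rightarrow> int) \<Rightarrow> int option \<Rightarrow> int option \<Rightarrow> int option" where
  "word_op w f u v = Option.bind u (\<lambda>a. Option.bind v (\<lambda>b. word w (f a b)))"

fun aval :: "nat \<Rightarrow> state \<Rightarrow> aexp \<Rightarrow> int option" where
  "aval w s (Const n) = word w n"
| "aval w s (Var x) = word w (vars s x)"
| "aval w s (Elem a e) =
     Option.bind (aval w s e) (\<lambda>i. if 0 \<le> i then word w (arrs s a (nat i)) else None)"
| "aval w s (Add e1 e2) = word_op w (+) (aval w s e1) (aval w s e2)"
| "aval w s (Sub e1 e2) = word_op w (-) (aval w s e1) (aval w s e2)"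
| "aval w s (Mul e1 e2) = word_op w (*) (aval w s e1) (aval w s e2)"
| "aval w s (Div e1 e2) =
     (if aval w s e2 = Some 0 then None else word_op w (div) (aval w s e1) (aval w s e2))"

fun bval :: "nat \<Rightarrow> state \<Rightarrow> bexp \<Rightarrow> bool option" where
  "bval w s (Less e1 e2) =
     Option.bind (aval w s e1) (\<lambda>a. Option.bind (aval w s e2) (\<lambda>b. Some (a < b)))"
| "bval w s (Neg b) = map_option Not (bval w s b)"
| "bval w s (And b1 b2) =
     Option.bind (bval w s b1) (\<lambda>p. Option.bind (bval w s b2) (\<lambda>q. Some (p \<and> q)))"

fun acost :: "aexp \<Rightarrow> nat" where
  "acost (Const n) = 1"
| "acost (Var x) = 1"
| "acost (Elem a e) = 1 + acost e"
| "acost (Add e1 e2) = 1 + acost e1 + acost e2"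
| "acost (Sub e1 e2) = 1 + acost e1 + acost e2"
| "acost (Mul e1 e2) = 1 + acost e1 + acost e2"
| "acost (Div e1 e2) = 1 + acost e1 + acost e2"

fun bcost :: "bexp \<Rightarrow> nat" where
  "bcost (Less e1 e2) = 1 + acost e1 + acost e2"
| "bcost (Neg b) = 1 + bcost b"
| "bcost (And b1 b2) = 1 + bcost b1 + bcost b2"

text \<open>
  \<open>exec w c s t s'\<close>: with word size \<open>w\<close>, program \<open>c\<close> started in \<open>s\<close> halts in \<open>s'\<close> after
  exactly \<open>t\<close> steps.
\<close>

inductive exec :: "nat \<Rightarrow> com \<Rightarrow> state \<Rightarrow> nat \<Rightarrow> state \<Rightarrow> bool" for w :: nat where
  Skip: "exec w Skip s 1 s"
| Assign: "aval w s e = Some v \<Longrightarrow>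
    exec w (Assign x e) s (1 + acost e) (s\<lparr>vars := (vars s)(x := v)\<rparr>)"
| Store: "aval w s e1 = Some i \<Longrightarrow> 0 \<le> i \<Longrightarrow> aval w s e2 = Some v \<Longrightarrow>
    exec w (Store a e1 e2) s (1 + acost e1 + acost e2)
      (s\<lparr>arrs := (arrs s)(a := (arrs s a)(nat i := v))\<rparr>)"
| Seq: "exec w c1 s t1 s1 \<Longrightarrow> exec w c2 s1 t2 s2 \<Longrightarrow> exec w (Seq c1 c2) s (t1 + t2) s2"
| CondTrue: "bval w s b = Some True \<Longrightarrow> exec w c1 s t s1 \<Longrightarrow>
    exec w (Cond b c1 c2) s (1 + bcost b + t) s1"
| CondFalse: "bval w s b = Some False \<Longrightarrow> exec w c2 s t s1 \<Longrightarrow>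
    exec w (Cond b c1 c2) s (1 + bcost b + t) s1"
| WhileFalse: "bval w s b = Some False \<Longrightarrow> exec w (While b c) s (1 + bcost b) s"
| WhileTrue: "bval w s b = Some True \<Longrightarrow> exec w c s t1 s1 \<Longrightarrow> exec w (While b c) s1 t2 s2 \<Longrightarrow>
    exec w (While b c) s (1 + bcost b + t1 + t2) s2"

inductive_cases exec_elims:
  "exec w Skip s t s'" "exec w (Assign x e) s t s'" "exec w (Store a e1 e2) s t s'"
  "exec w (Seq c1 c2) s t s'" "exec w (Cond b c1 c2) s t s'"
  "exec w (While b c) s t s'"

lemma exec_deterministic:
  "exec w c s t s' \<Longrightarrow> exec w c s u s'' \<Longrightarrow> t = u \<and> s' = s''"
proof (induction arbitrary: u s'' rule: exec.induct)
  case (Skip s)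
  then show ?case by (rule exec_elims(1)) simp
next
  case (Assign s e v x)
  from Assign.prems show ?case by (rule exec_elims(2)) (use Assign.hyps in simp)
next
  case (Store s e1 i e2 v a)
  from Store.prems show ?case by (rule exec_elims(3)) (use Store.hyps in simp)
next
  case (Seq c1 s t1 s1 c2 t2 s2)
  from Seq.prems obtain t1' s1' t2' where
    u: "u = t1' + t2'" and 1: "exec w c1 s t1' s1'" and 2: "exec w c2 s1' t2' s''"
    by (rule exec_elims(4))
  from Seq.IH(1)[OF 1] have eq: "t1 = t1'" "s1 = s1'" by simp_all
  from Seq.IH(2)[OF 2[folded eq(2)]] show ?case by (simp add: u eq(1))
next
  case (CondTrue s b c1 t s1 c2)
  from CondTrue.prems show ?case
    by (rule exec_elims(5)) (use CondTrue.hyps in \<open>auto dest: CondTrue.IH\<close>)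
next
  case (CondFalse s b c2 t s1 c1)
  from CondFalse.prems show ?case
    by (rule exec_elims(5)) (use CondFalse.hyps in \<open>auto dest: CondFalse.IH\<close>)
next
  case (WhileFalse s b c)
  from WhileFalse.prems show ?case by (rule exec_elims(6)) (use WhileFalse.hyps in simp_all)
next
  case (WhileTrue s b c t1 s1 t2 s2)
  from WhileTrue.prems obtain t1' s1' t2' where
    u: "u = 1 + bcost b + t1' + t2'" and
    1: "exec w c s t1' s1'" and 2: "exec w (While b c) s1' t2' s''"
    by (rule exec_elims(6)) (use WhileTrue.hyps in simp_all)
  from WhileTrue.IH(1)[OF 1] have eq: "t1 = t1'" "s1 = s1'" by simp_all
  from WhileTrue.IH(2)[OF 2[folded eq(2)]] show ?case by (simp add: u eq(1))
qed


subsection \<open>Input, output and resource bounds\<close>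

text \<open>
  Coefficients are stored in a common fixed-point format: the mantissa \<open>m i\<close> stands for
  \<open>m i \<cdot> 2\<^sup>e\<close>. The number of bits of a mantissa is its length in two's complement.
\<close>

definition decode :: "int \<Rightarrow> (nat \<Rightarrow> int) \<Rightarrow> nat \<Rightarrow> real" where
  "decode e m i = of_int (m i) * 2 powi e"

definition bits :: "int \<Rightarrow> nat" where
  "bits n = (LEAST b. 0 < b \<and> - (2 ^ (b - 1)) \<le> n \<and> n < 2 ^ (b - 1))"

definition max_bits :: "nat \<Rightarrow> (nat \<Rightarrow> int) \<Rightarrow> nat" where
  "max_bits d m = Max ((\<lambda>i. bits (m i)) ` {1..d})"

definition input_state :: "nat \<Rightarrow> nat \<Rightarrow> nat \<Rightarrow> (nat \<Rightarrow> int) \<Rightarrow> state" where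
  "input_state d k \<Delta> m = \<lparr>
     vars = (\<lambda>_. 0)(''d'' := int d, ''k'' := int k, ''Delta'' := int \<Delta>),
     arrs = (\<lambda>_ _. 0)(''x'' := (\<lambda>i. if i \<in> {1..d} then m i else 0)) \<rparr>"

definition output_array :: "state \<Rightarrow> nat \<Rightarrow> int" where
  "output_array s = arrs s ''xhat''"

text \<open>A word is a constant factor \<open>c\<close> longer than what is needed to store the input numbers.\<close>

definition word_size :: "nat \<Rightarrow> nat \<Rightarrow> nat \<Rightarrow> nat \<Rightarrow> nat \<Rightarrow> nat" where
  "word_size c d k \<Delta> \<gamma> = c * (\<gamma> + bits (int d) + bits (int k) + bits (int \<Delta>))"

text \<open>
  As usual in running times, a logarithmic factor is read as at least 1; otherwise the bound
  would be 0 for \<open>d = 1\<close> or \<open>\<Delta> = 1\<close>.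
\<close>

definition lg :: "nat \<Rightarrow> real" where
  "lg n = max 1 (log 2 (real n))"

end

theory Submission
  imports Defs
begin

text \<open>
  Give coordinate \<open>i\<close> the weight \<open>f i = 2 ((k + 1) m\<^sub>i\<^sup>2 + [m\<^sub>i \<noteq> 0])\<close>; a separated \<open>k\<close>-set of
  maximal weight solves both versions of the projection problem. Lagrangian relaxation replaces the
  constraint \<open>|\<Omega>| = k\<close> by a penalty \<open>\<mu>\<close> per element, and the relaxed problem is solved by a
  linear-time dynamic program. Two separated sets of sizes \<open>l \<le> n \<le> r\<close> can be cut and crossed over
  into separated sets of sizes \<open>n\<close> and \<open>l + r - n\<close>, so the optimal value is concave in the size, and
  its slopes are even. Hence an optimum for an odd penalty is optimal for both neighbouring even
  penalties as well. \<open>O(\<gamma> + log k)\<close> bisection steps find an even \<open>\<mu>\<close> such that the program returns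
  fewer than \<open>k\<close> elements for \<open>\<mu> + 1\<close> and at least \<open>k\<close> for \<open>\<mu> - 1\<close>. Both sets are optimal for \<open>\<mu>\<close>,
  and crossing them over gives an optimal set of size exactly \<open>k\<close>.
\<close>

section \<open>Timed execution\<close>

notation Assign (infix "::=" 61)
notation Seq (infixl ";;" 60)
notation Store ("_\<langle>_\<rangle> \<leftarrow> _" [1000, 0, 62] 61)
notation Cond ("(IF _/ THEN _/ ELSE _)" [0, 0, 61] 61)
notation While ("(WHILE _/ DO _)" [0, 61] 61)
notation Elem ("_\<langle>_\<rangle>" [1000, 0] 1000)
notation Add (infixl "\<oplus>" 65)
notation Sub (infixl "\<ominus>" 65)
notation Mul (infixl "\<otimes>" 70)
notation Div (infixl "\<oslash>" 70)
notation Less (infix "\<prec>" 50)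

abbreviation set_var :: "vname \<Rightarrow> int \<Rightarrow> state \<Rightarrow> state" where
  "set_var v a s \<equiv> s\<lparr>vars := (vars s)(v := a)\<rparr>"

abbreviation set_elem :: "vname \<Rightarrow> nat \<Rightarrow> int \<Rightarrow> state \<Rightarrow> state" where
  "set_elem v i a s \<equiv> s\<lparr>arrs := (arrs s)(v := (arrs s v)(i := a))\<rparr>"

subsection \<open>Frames\<close>

fun written_vars :: "com \<Rightarrow> vname set" where
  "written_vars Skip = {}"
| "written_vars (v ::= e) = {v}"
| "written_vars (v\<langle>e\<rangle> \<leftarrow> e') = {}"
| "written_vars (c1 ;; c2) = written_vars c1 \<union> written_vars c2"
| "written_vars (IF b THEN c1 ELSE c2) = written_vars c1 \<union> written_vars c2"
| "written_vars (WHILE b DO c) = written_vars c"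

fun written_arrs :: "com \<Rightarrow> vname set" where
  "written_arrs Skip = {}"
| "written_arrs (v ::= e) = {}"
| "written_arrs (v\<langle>e\<rangle> \<leftarrow> e') = {v}"
| "written_arrs (c1 ;; c2) = written_arrs c1 \<union> written_arrs c2"
| "written_arrs (IF b THEN c1 ELSE c2) = written_arrs c1 \<union> written_arrs c2"
| "written_arrs (WHILE b DO c) = written_arrs c"

definition unchanged_outside :: "com \<Rightarrow> state \<Rightarrow> state \<Rightarrow> bool" where
  "unchanged_outside c s s' \<longleftrightarrow> (\<forall>v. v \<notin> written_vars c \<longrightarrow> vars s' v = vars s v) \<and>
     (\<forall>v. v \<notin> written_arrs c \<longrightarrow> arrs s' v = arrs s v)"

lemma unchanged_outside_refl: "unchanged_outside c s s"
  by (simp add: unchanged_outside_def)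

lemma unchanged_outside_trans:
  "unchanged_outside c s s' \<Longrightarrow> unchanged_outside c s' s'' \<Longrightarrow> unchanged_outside c s s''"
  by (simp add: unchanged_outside_def)

lemma exec_unchanged_outside: "exec w c s t s' \<Longrightarrow> unchanged_outside c s s'"
  by (induction rule: exec.induct) (auto simp: unchanged_outside_def)

subsection \<open>Total correctness within a time bound\<close>

definition runs :: "nat \<Rightarrow> com \<Rightarrow> state \<Rightarrow> nat \<Rightarrow> (state \<Rightarrow> bool) \<Rightarrow> bool" where
  "runs w c s T Q \<longleftrightarrow> (\<exists>t s'. exec w c s t s' \<and> t \<le> T \<and> Q s')"

lemma runsI: "exec w c s t s' \<Longrightarrow> t \<le> T \<Longrightarrow> Q s' \<Longrightarrow> runs w c s T Q"
  unfolding runs_def by blast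

lemma runs_conseq:
  assumes "runs w c s T Q" "T \<le> T'" "\<And>s'. Q s' \<Longrightarrow> unchanged_outside c s s' \<Longrightarrow> Q' s'"
  shows "runs w c s T' Q'"
  using assms exec_unchanged_outside order_trans unfolding runs_def by blast

lemma runs_Seq:
  assumes "runs w c1 s T1 R"
    and "\<And>s'. R s' \<Longrightarrow> unchanged_outside c1 s s' \<Longrightarrow> runs w c2 s' T2 Q"
  shows "runs w (c1 ;; c2) s (T1 + T2) Q"
proof -
  obtain t1 s1 where first: "exec w c1 s t1 s1" "t1 \<le> T1" "R s1"
    using assms(1) by (auto simp: runs_def)
  then obtain t2 s2 where "exec w c2 s1 t2 s2" "t2 \<le> T2" "Q s2"
    using assms(2) exec_unchanged_outside by (fastforce simp: runs_def)
  with first show ?thesis by (intro runsI[OF exec.Seq]) auto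
qed

definition hoare :: "nat \<Rightarrow> (state \<Rightarrow> bool) \<Rightarrow> com \<Rightarrow> nat \<Rightarrow> (state \<Rightarrow> bool) \<Rightarrow> bool" where
  "hoare w P c T Q \<longleftrightarrow> (\<forall>s. P s \<longrightarrow> runs w c s T Q)"

lemma hoareI: "(\<And>s. P s \<Longrightarrow> runs w c s T Q) \<Longrightarrow> hoare w P c T Q"
  by (simp add: hoare_def)

lemma hoareD: "hoare w P c T Q \<Longrightarrow> P s \<Longrightarrow> runs w c s T Q"
  by (simp add: hoare_def)

lemma hoare_Seq [trans]:
  "hoare w P c1 T1 R \<Longrightarrow> hoare w R c2 T2 Q \<Longrightarrow> hoare w P (c1 ;; c2) (T1 + T2) Q"
  by (auto simp: hoare_def intro: runs_Seq)

fun ideal_aval :: "state \<Rightarrow> aexp \<Rightarrow> int" where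
  "ideal_aval s (Const n) = n"
| "ideal_aval s (Var v) = vars s v"
| "ideal_aval s (v\<langle>e\<rangle>) = arrs s v (nat (ideal_aval s e))"
| "ideal_aval s (e1 \<oplus> e2) = ideal_aval s e1 + ideal_aval s e2"
| "ideal_aval s (e1 \<ominus> e2) = ideal_aval s e1 - ideal_aval s e2"
| "ideal_aval s (e1 \<otimes> e2) = ideal_aval s e1 * ideal_aval s e2"
| "ideal_aval s (e1 \<oslash> e2) = ideal_aval s e1 div ideal_aval s e2"

fun ideal_bval :: "state \<Rightarrow> bexp \<Rightarrow> bool" where
  "ideal_bval s (e1 \<prec> e2) \<longleftrightarrow> ideal_aval s e1 < ideal_aval s e2"
| "ideal_bval s (Neg b) \<longleftrightarrow> \<not> ideal_bval s b"
| "ideal_bval s (And b1 b2) \<longleftrightarrow> ideal_bval s b1 \<and> ideal_bval s b2"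

definition fits :: "nat \<Rightarrow> int \<Rightarrow> bool" where
  "fits w a \<longleftrightarrow> \<bar>a\<bar> < 2 ^ w"

fun safe_aexp :: "nat \<Rightarrow> state \<Rightarrow> aexp \<Rightarrow> bool" where
  "safe_aexp w s (Const n) \<longleftrightarrow> fits w n"
| "safe_aexp w s (Var v) \<longleftrightarrow> fits w (vars s v)"
| "safe_aexp w s (v\<langle>e\<rangle>) \<longleftrightarrow>
     safe_aexp w s e \<and> 0 \<le> ideal_aval s e \<and> fits w (ideal_aval s (v\<langle>e\<rangle>))"
| "safe_aexp w s (e1 \<oplus> e2) \<longleftrightarrow>
     safe_aexp w s e1 \<and> safe_aexp w s e2 \<and> fits w (ideal_aval s (e1 \<oplus> e2))"
| "safe_aexp w s (e1 \<ominus> e2) \<longleftrightarrow>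
     safe_aexp w s e1 \<and> safe_aexp w s e2 \<and> fits w (ideal_aval s (e1 \<ominus> e2))"
| "safe_aexp w s (e1 \<otimes> e2) \<longleftrightarrow>
     safe_aexp w s e1 \<and> safe_aexp w s e2 \<and> fits w (ideal_aval s (e1 \<otimes> e2))"
| "safe_aexp w s (e1 \<oslash> e2) \<longleftrightarrow>
     safe_aexp w s e1 \<and> safe_aexp w s e2 \<and> ideal_aval s e2 \<noteq> 0 \<and> fits w (ideal_aval s (e1 \<oslash> e2))"

fun safe_bexp :: "nat \<Rightarrow> state \<Rightarrow> bexp \<Rightarrow> bool" where
  "safe_bexp w s (e1 \<prec> e2) \<longleftrightarrow> safe_aexp w s e1 \<and> safe_aexp w s e2"
| "safe_bexp w s (Neg b) \<longleftrightarrow> safe_bexp w s b"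
| "safe_bexp w s (And b1 b2) \<longleftrightarrow> safe_bexp w s b1 \<and> safe_bexp w s b2"

lemma aval_safe: "safe_aexp w s e \<Longrightarrow> aval w s e = Some (ideal_aval s e)"
  by (induction e) (auto simp: word_op_def word_def fits_def)

lemma bval_safe: "safe_bexp w s b \<Longrightarrow> bval w s b = Some (ideal_bval s b)"
  by (induction b) (auto simp: aval_safe)

lemma runs_Cond:
  assumes "safe_bexp w s b"
    and "ideal_bval s b \<Longrightarrow> runs w c1 s T Q" "\<not> ideal_bval s b \<Longrightarrow> runs w c2 s T Q"
  shows "runs w (IF b THEN c1 ELSE c2) s (1 + bcost b + T) Q"
proof (cases "ideal_bval s b")
  case True
  with assms bval_safe show ?thesis by (force simp: runs_def intro: exec.CondTrue)
next
  case False
  with assms bval_safe show ?thesis by (force simp: runs_def intro: exec.CondFalse)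
qed

lemma runs_While:
  assumes inv: "I N s"
    and safe: "\<And>n s'. I n s' \<Longrightarrow> unchanged_outside c s s' \<Longrightarrow> safe_bexp w s' b"
    and exit: "\<And>n s'. I n s' \<Longrightarrow> unchanged_outside c s s' \<Longrightarrow> \<not> ideal_bval s' b \<Longrightarrow> Q s'"
    and step: "\<And>n s'. I n s' \<Longrightarrow> unchanged_outside c s s' \<Longrightarrow> ideal_bval s' b \<Longrightarrow>
      runs w c s' T (\<lambda>s''. \<exists>n'<n. I n' s'')"
  shows "runs w (WHILE b DO c) s (N * (1 + bcost b + T) + (1 + bcost b)) Q"
proof -
  let ?time = "\<lambda>n. n * (1 + bcost b + T) + (1 + bcost b)"
  have "runs w (WHILE b DO c) s' (?time n) Q" if "I n s'" "unchanged_outside c s s'" for n s'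
    using that
  proof (induction n arbitrary: s' rule: less_induct)
    case (less n)
    have test: "bval w s' b = Some (ideal_bval s' b)"
      by (rule bval_safe[OF safe[OF less.prems]])
    show ?case
    proof (cases "ideal_bval s' b")
      case False
      with test exit[OF less.prems] show ?thesis by (auto intro: runsI[OF exec.WhileFalse])
    next
      case True
      from step[OF less.prems True] obtain t1 s1 n' where
        body: "exec w c s' t1 s1" "t1 \<le> T" and n': "n' < n" "I n' s1"
        by (auto simp: runs_def)
      have "unchanged_outside c s s1"
        using unchanged_outside_trans[OF less.prems(2) exec_unchanged_outside[OF body(1)]] .
      from less.IH[OF n' this] obtain t2 s2 where
        rest: "exec w (WHILE b DO c) s1 t2 s2" "t2 \<le> ?time n'" "Q s2"
        by (auto simp: runs_def)
      have "?time n' + (1 + bcost b + T) \<le> ?time n"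
        using mult_right_mono[of "Suc n'" n "1 + bcost b + T"] n'(1) by simp
      with body rest test True show ?thesis
        by (intro runsI[OF exec.WhileTrue[OF _ body(1) rest(1)]]) auto
    qed
  qed
  then show ?thesis using inv unchanged_outside_refl by blast
qed

subsection \<open>Loop-free programs\<close>

text \<open>The values of the following two functions on loops are junk.\<close>

fun wp :: "nat \<Rightarrow> com \<Rightarrow> (state \<Rightarrow> bool) \<Rightarrow> state \<Rightarrow> bool" where
  "wp w Skip Q s \<longleftrightarrow> Q s"
| "wp w (v ::= e) Q s \<longleftrightarrow> safe_aexp w s e \<and> Q (set_var v (ideal_aval s e) s)"
| "wp w (v\<langle>e\<rangle> \<leftarrow> e') Q s \<longleftrightarrow> safe_aexp w s e \<and> 0 \<le> ideal_aval s e \<and> safe_aexp w s e' \<and>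
     Q (set_elem v (nat (ideal_aval s e)) (ideal_aval s e') s)"
| "wp w (c1 ;; c2) Q s \<longleftrightarrow> wp w c1 (wp w c2 Q) s"
| "wp w (IF b THEN c1 ELSE c2) Q s \<longleftrightarrow>
     safe_bexp w s b \<and> (if ideal_bval s b then wp w c1 Q s else wp w c2 Q s)"
| "wp w (WHILE b DO c) Q s \<longleftrightarrow> False"

fun max_cost :: "com \<Rightarrow> nat" where
  "max_cost Skip = 1"
| "max_cost (v ::= e) = 1 + acost e"
| "max_cost (v\<langle>e\<rangle> \<leftarrow> e') = 1 + acost e + acost e'"
| "max_cost (c1 ;; c2) = max_cost c1 + max_cost c2"
| "max_cost (IF b THEN c1 ELSE c2) = 1 + bcost b + max (max_cost c1) (max_cost c2)"
| "max_cost (WHILE b DO c) = 0"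

lemma runs_max_cost: "wp w c Q s \<Longrightarrow> runs w c s (max_cost c) Q"
proof (induction c arbitrary: Q s)
  case Skip
  then show ?case by (auto intro: runsI[OF exec.Skip])
next
  case (Assign v e)
  then show ?case by (auto intro: runsI[OF exec.Assign[OF aval_safe]])
next
  case (Store v e e')
  then show ?case by (auto intro: runsI[OF exec.Store[OF aval_safe _ aval_safe]])
next
  case (Seq c1 c2)
  from Seq.prems have "runs w c1 s (max_cost c1) (wp w c2 Q)" by (simp add: Seq.IH(1))
  then show ?case unfolding max_cost.simps by (rule runs_Seq) (rule Seq.IH(2))
next
  case (Cond b c1 c2)
  let ?T = "max (max_cost c1) (max_cost c2)"
  from Cond.prems have safe: "safe_bexp w s b" by simp
  show ?case unfolding max_cost.simps
  proof (rule runs_Cond[OF safe])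
    assume "ideal_bval s b"
    with Cond.prems have "runs w c1 s (max_cost c1) Q" by (intro Cond.IH) simp
    then show "runs w c1 s ?T Q" by (rule runs_conseq) simp_all
  next
    assume "\<not> ideal_bval s b"
    with Cond.prems have "runs w c2 s (max_cost c2) Q" by (intro Cond.IH) simp
    then show "runs w c2 s ?T Q" by (rule runs_conseq) simp_all
  qed
qed simp

lemma runs_wp: "wp w c Q s \<Longrightarrow> max_cost c \<le> T \<Longrightarrow> runs w c s T Q"
  by (rule runs_conseq[OF runs_max_cost])

subsection \<open>Counting loops\<close>

definition for_com :: "vname \<Rightarrow> vname \<Rightarrow> com \<Rightarrow> com" ("(FOR _ \<le> _ DO _)" [0, 0, 61] 61) where
  "FOR i \<le> n DO c = i ::= Const 0 ;; WHILE Var i \<prec> Var n DO (i ::= Var i \<oplus> Const 1 ;; c)"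

lemma written_for [simp]:
  "written_vars (FOR i \<le> n DO c) = insert i (written_vars c)"
  "written_arrs (FOR i \<le> n DO c) = written_arrs c"
  by (simp_all add: for_com_def)

lemma runs_for:
  assumes bound: "vars s n = int N" "fits w (int N)" "fits w 1"
    and unwritten: "i \<noteq> n" "i \<notin> written_vars c" "n \<notin> written_vars c"
    and inv: "I 0 s"
    and indep: "\<And>j s' a. I j s' \<Longrightarrow> I j (set_var i a s')"
    and step: "\<And>j s'. j < N \<Longrightarrow> I j s' \<Longrightarrow> vars s' i = int (Suc j) \<Longrightarrow>
      unchanged_outside (FOR i \<le> n DO c) s s' \<Longrightarrow> runs w c s' T (I (Suc j))"
  shows "runs w (FOR i \<le> n DO c) s (N * (T + 8) + 6) (I N)"
proof -
  let ?b = "Var i \<prec> Var n" and ?inc = "i ::= Var i \<oplus> Const 1"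
  let ?inv = "\<lambda>r s'. \<exists>j\<le>N. r = N - j \<and> vars s' i = int j \<and> I j s'"
  have fits: "fits w (int j)" if "j \<le> N" for j using that bound(2) by (simp add: fits_def)
  have init: "runs w (i ::= Const 0) s 2 (?inv N)"
    using inv indep fits[of 0] by (intro runs_wp) (auto intro!: exI[of _ 0])
  have loop: "runs w (WHILE ?b DO (?inc ;; c)) s1 (N * (1 + bcost ?b + (4 + T)) + (1 + bcost ?b)) (I N)"
    if inv1: "?inv N s1" and unchanged1: "unchanged_outside (i ::= Const 0) s s1" for s1
  proof (rule runs_While[where I = ?inv, OF inv1])
    fix r s' assume "?inv r s'" and "unchanged_outside (?inc ;; c) s1 s'"
    then obtain j where j: "j \<le> N" "r = N - j" "vars s' i = int j" "I j s'"
      and s': "vars s' n = int N" "unchanged_outside (FOR i \<le> n DO c) s s'"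
      using unchanged1 bound(1) unwritten by (auto simp: unchanged_outside_def)
    show "safe_bexp w s' ?b" using j fits bound s' by simp
    show "I N s'" if "\<not> ideal_bval s' ?b" using that j s' by simp
    assume "ideal_bval s' ?b"
    then have less: "j < N" using j s' by simp
    let ?s = "set_var i (int (Suc j)) s'"
    have "runs w ?inc s' 4 (\<lambda>s''. s'' = ?s)"
      using j(3) less fits[of j] fits[of "Suc j"] bound(3) by (intro runs_wp) (auto simp: add.commute)
    then show "runs w (?inc ;; c) s' (4 + T) (\<lambda>s''. \<exists>r'<r. ?inv r' s'')"
    proof (rule runs_Seq, clarify)
      have "unchanged_outside (FOR i \<le> n DO c) s ?s"
        using s'(2) by (simp add: unchanged_outside_def)
      then have "runs w c ?s T (I (Suc j))" using less j(4) indep by (intro step) auto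
      then show "runs w c ?s T (\<lambda>s''. \<exists>r'<r. ?inv r' s'')"
      proof (rule runs_conseq)
        fix s3 assume "I (Suc j) s3" "unchanged_outside c ?s s3"
        with unwritten less j(2) show "\<exists>r'<r. ?inv r' s3"
          by (intro exI[of _ "N - Suc j"] conjI exI[of _ "Suc j"]) (auto simp: unchanged_outside_def)
      qed simp
    qed
  qed
  from runs_Seq[OF init loop] show ?thesis
    unfolding for_com_def by (rule runs_conseq) (simp_all add: algebra_simps)
qed

section \<open>Separated sets\<close>

subsection \<open>Separated sets as descending lists\<close>

definition sep_list :: "nat \<Rightarrow> nat \<Rightarrow> nat list \<Rightarrow> bool" where
  "sep_list \<Delta> d xs \<longleftrightarrow> sorted_wrt (\<lambda>a b. b + \<Delta> \<le> a) xs \<and> set xs \<subseteq> {1..d}"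

lemma sep_list_Nil [simp]: "sep_list \<Delta> d []"
  by (simp add: sep_list_def)

lemma sep_list_Cons:
  "sep_list \<Delta> d (x # xs) \<longleftrightarrow> x \<in> {1..d} \<and> (\<forall>y\<in>set xs. y + \<Delta> \<le> x) \<and> sep_list \<Delta> d xs"
  by (auto simp: sep_list_def)

lemma sep_list_mono: "sep_list \<Delta> d xs \<Longrightarrow> d \<le> d' \<Longrightarrow> sep_list \<Delta> d' xs"
  by (auto simp: sep_list_def)

lemma sep_list_restrict: "sep_list \<Delta> d xs \<Longrightarrow> (\<And>x. x \<in> set xs \<Longrightarrow> x \<le> d') \<Longrightarrow> sep_list \<Delta> d' xs"
  by (auto simp: sep_list_def)

lemma sep_list_set_subset: "sep_list \<Delta> d xs \<Longrightarrow> set xs \<subseteq> {1..d}"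
  by (simp add: sep_list_def)

lemma sep_list_nth_mem: "sep_list \<Delta> d xs \<Longrightarrow> i < length xs \<Longrightarrow> xs ! i \<in> {1..d}"
  using sep_list_set_subset nth_mem by blast

lemma sep_list_nth_gap: "sep_list \<Delta> d xs \<Longrightarrow> i < j \<Longrightarrow> j < length xs \<Longrightarrow> xs ! j + \<Delta> \<le> xs ! i"
  by (auto simp: sep_list_def sorted_wrt_iff_nth_less)

lemma sep_list_nth_antimono: "sep_list \<Delta> d xs \<Longrightarrow> i \<le> j \<Longrightarrow> j < length xs \<Longrightarrow> xs ! j \<le> xs ! i"
  using sep_list_nth_gap[of \<Delta> d xs i j] by (cases "i = j") auto

lemma distinct_sep_list:
  assumes "sep_list \<Delta> d xs" "1 \<le> \<Delta>"
  shows "distinct xs"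
  using assms(1)
proof (induction xs)
  case (Cons x xs)
  then show ?case using assms(2) by (force simp: sep_list_Cons)
qed simp

lemma length_sep_list_le:
  assumes "sep_list \<Delta> d xs" "1 \<le> \<Delta>"
  shows "length xs \<le> d"
  using card_mono[OF _ sep_list_set_subset[OF assms(1)]] distinct_card[OF distinct_sep_list[OF assms]]
  by simp

lemma sep_ge_iff: "enat \<Delta> \<le> sep \<Omega> \<longleftrightarrow> (\<forall>i\<in>\<Omega>. \<forall>j\<in>\<Omega>. i < j \<longrightarrow> i + \<Delta> \<le> j)"
proof
  assume "enat \<Delta> \<le> sep \<Omega>"
  then have "\<Delta> \<le> nat \<bar>int i - int j\<bar>" if "i \<in> \<Omega>" "j \<in> \<Omega>" "i \<noteq> j" for i j
    using that unfolding sep_def le_INF_iff by fastforce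
  then show "\<forall>i\<in>\<Omega>. \<forall>j\<in>\<Omega>. i < j \<longrightarrow> i + \<Delta> \<le> j" by fastforce
next
  assume gap: "\<forall>i\<in>\<Omega>. \<forall>j\<in>\<Omega>. i < j \<longrightarrow> i + \<Delta> \<le> j"
  have "\<Delta> \<le> nat \<bar>int i - int j\<bar>" if "i \<in> \<Omega>" "j \<in> \<Omega>" "i \<noteq> j" for i j
    using that gap by (cases "i < j") (fastforce simp: abs_if)+
  then show "enat \<Delta> \<le> sep \<Omega>" unfolding sep_def le_INF_iff by auto
qed

lemma set_sep_list_in_sep_sets_card:
  assumes xs: "sep_list \<Delta> d xs" and \<Delta>: "1 \<le> \<Delta>"
  shows "set xs \<in> sep_sets_card d (length xs) \<Delta>"
proof -
  have "i + \<Delta> \<le> j" if ij: "i \<in> set xs" "j \<in> set xs" "i < j" for i j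
  proof -
    from ij obtain p q where pq: "p < length xs" "xs ! p = i" "q < length xs" "xs ! q = j"
      by (metis in_set_conv_nth)
    then have "q < p" using sep_list_nth_antimono[OF xs, of p q] ij(3) by (meson leD not_le)
    then show ?thesis using sep_list_nth_gap[OF xs, of q p] pq by simp
  qed
  then show ?thesis
    using sep_list_set_subset[OF xs] distinct_card[OF distinct_sep_list[OF assms]]
    by (auto simp: sep_sets_card_def sep_sets_def sep_ge_iff)
qed

lemma sep_sets_card_obtain_sep_list:
  assumes "\<Omega> \<in> sep_sets_card d k \<Delta>"
  obtains xs where "sep_list \<Delta> d xs" "length xs = k" "set xs = \<Omega>"
proof
  have \<Omega>: "\<Omega> \<subseteq> {1..d}" "card \<Omega> = k" and gap: "\<forall>i\<in>\<Omega>. \<forall>j\<in>\<Omega>. i < j \<longrightarrow> i + \<Delta> \<le> j"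
    using assms by (auto simp: sep_sets_card_def sep_sets_def sep_ge_iff)
  then have fin: "finite \<Omega>" using finite_subset by blast
  have "sorted_wrt (\<lambda>a b. a + \<Delta> \<le> b) (sorted_list_of_set \<Omega>)"
    by (rule sorted_wrt_mono_rel[OF _ strict_sorted_list_of_set]) (use gap fin in auto)
  then show "sep_list \<Delta> d (rev (sorted_list_of_set \<Omega>))"
    using \<Omega> fin by (auto simp: sep_list_def sorted_wrt_rev)
  show "length (rev (sorted_list_of_set \<Omega>)) = k" "set (rev (sorted_list_of_set \<Omega>)) = \<Omega>"
    using \<Omega> fin by simp_all
qed

subsection \<open>Crossover\<close>

text \<open>
  \<open>blocked \<Delta> s xs ys i\<close> says that the first \<open>i + s\<close> elements of \<open>ys\<close> cannot be followed by \<open>drop i xs\<close>.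
  Before the least unblocked index \<open>ys\<close> lags behind \<open>xs\<close>, so that the opposite exchange of tails
  is separated, too.
\<close>

definition blocked :: "nat \<Rightarrow> nat \<Rightarrow> nat list \<Rightarrow> nat list \<Rightarrow> nat \<Rightarrow> bool" where
  "blocked \<Delta> s xs ys i \<longleftrightarrow> i < length xs \<and> 0 < i + s \<and> ys ! (i + s - 1) < xs ! i + \<Delta>"

definition crossover_point :: "nat \<Rightarrow> nat \<Rightarrow> nat list \<Rightarrow> nat list \<Rightarrow> nat" where
  "crossover_point \<Delta> s xs ys = (LEAST i. \<not> blocked \<Delta> s xs ys i)"

definition crossover :: "nat \<Rightarrow> nat \<Rightarrow> nat list \<Rightarrow> nat list \<Rightarrow> nat list" where
  "crossover \<Delta> s xs ys =
     take (crossover_point \<Delta> s xs ys) xs @ drop (crossover_point \<Delta> s xs ys + s) ys"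

definition cocrossover :: "nat \<Rightarrow> nat \<Rightarrow> nat list \<Rightarrow> nat list \<Rightarrow> nat list" where
  "cocrossover \<Delta> s xs ys =
     take (crossover_point \<Delta> s xs ys + s) ys @ drop (crossover_point \<Delta> s xs ys) xs"

lemma crossover_point_le_length: "crossover_point \<Delta> s xs ys \<le> length xs"
  unfolding crossover_point_def by (rule Least_le) (simp add: blocked_def)

lemma not_blocked_crossover_point: "\<not> blocked \<Delta> s xs ys (crossover_point \<Delta> s xs ys)"
  unfolding crossover_point_def by (rule LeastI[of _ "length xs"]) (simp add: blocked_def)

lemma blocked_less_crossover_point: "i < crossover_point \<Delta> s xs ys \<Longrightarrow> blocked \<Delta> s xs ys i"
  unfolding crossover_point_def using not_less_Least by blast

lemma sep_list_take_append_drop: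
  assumes xs: "sep_list \<Delta> d xs" and ys: "sep_list \<Delta> d ys" and i: "i \<le> length xs"
    and link: "0 < i \<Longrightarrow> j < length ys \<Longrightarrow> ys ! j + \<Delta> \<le> xs ! (i - 1)"
  shows "sep_list \<Delta> d (take i xs @ drop j ys)"
proof -
  have "b + \<Delta> \<le> a" if ab: "a \<in> set (take i xs)" "b \<in> set (drop j ys)" for a b
  proof -
    from ab(1) i obtain p where p: "p < i" "a = xs ! p"
      by (auto simp: in_set_conv_nth)
    from ab(2) obtain q where "q < length (drop j ys)" "b = drop j ys ! q"
      by (auto simp only: in_set_conv_nth)
    then have q: "j + q < length ys" "b = ys ! (j + q)" by auto
    have "b \<le> ys ! j" using sep_list_nth_antimono[OF ys, of j "j + q"] q by simp
    moreover have "xs ! (i - 1) \<le> a" using sep_list_nth_antimono[OF xs, of p "i - 1"] p i by simp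
    moreover have "ys ! j + \<Delta> \<le> xs ! (i - 1)" using link p q by simp
    ultimately show ?thesis by simp
  qed
  moreover have "sorted_wrt (\<lambda>a b. b + \<Delta> \<le> a) (take i xs)"
    "sorted_wrt (\<lambda>a b. b + \<Delta> \<le> a) (drop j ys)"
    using xs ys by (auto simp: sep_list_def)
  ultimately show ?thesis
    using xs ys by (auto simp: sep_list_def sorted_wrt_append dest: in_set_takeD in_set_dropD)
qed

lemma sep_list_crossover:
  assumes xs: "sep_list \<Delta> d xs" and ys: "sep_list \<Delta> d ys"
  shows "sep_list \<Delta> d (crossover \<Delta> s xs ys)"
  unfolding crossover_def
proof (rule sep_list_take_append_drop[OF xs ys crossover_point_le_length])
  let ?i = "crossover_point \<Delta> s xs ys"
  assume i: "0 < ?i" "?i + s < length ys"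
  then have "blocked \<Delta> s xs ys (?i - 1)" by (intro blocked_less_crossover_point) simp
  then have lag: "2 \<le> ?i + s" "ys ! (?i + s - 2) < xs ! (?i - 1) + \<Delta>"
    using i(1) by (auto simp: blocked_def numeral_2_eq_2)
  have "ys ! (?i + s) + \<Delta> \<le> ys ! (?i + s - 1)" "ys ! (?i + s - 1) + \<Delta> \<le> ys ! (?i + s - 2)"
    using i lag(1) by (auto intro!: sep_list_nth_gap[OF ys])
  with lag(2) show "ys ! (?i + s) + \<Delta> \<le> xs ! (?i - 1)" by simp
qed

lemma sep_list_cocrossover:
  assumes "sep_list \<Delta> d xs" "sep_list \<Delta> d ys" "length xs + s \<le> length ys"
  shows "sep_list \<Delta> d (cocrossover \<Delta> s xs ys)"
  unfolding cocrossover_def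
  using assms not_blocked_crossover_point[of \<Delta> s xs ys] crossover_point_le_length[of \<Delta> s xs ys]
  by (intro sep_list_take_append_drop) (auto simp: blocked_def)

lemma length_crossover: "length xs + s \<le> length ys \<Longrightarrow> length (crossover \<Delta> s xs ys) = length ys - s"
  using crossover_point_le_length[of \<Delta> s xs ys] by (simp add: crossover_def)

lemma length_cocrossover: "length xs + s \<le> length ys \<Longrightarrow> length (cocrossover \<Delta> s xs ys) = length xs + s"
  using crossover_point_le_length[of \<Delta> s xs ys] by (simp add: cocrossover_def)

lemma nth_crossover:
  assumes "length xs + s \<le> length ys" "j < length ys - s"
  shows "crossover \<Delta> s xs ys ! j = (if j < crossover_point \<Delta> s xs ys then xs ! j else ys ! (j + s))"
  using assms crossover_point_le_length[of \<Delta> s xs ys]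
  by (auto simp: crossover_def nth_append add.commute)

lemma sum_list_crossover:
  fixes g :: "nat \<Rightarrow> 'a :: comm_monoid_add"
  shows "(\<Sum>x\<leftarrow>crossover \<Delta> s xs ys. g x) + (\<Sum>x\<leftarrow>cocrossover \<Delta> s xs ys. g x)
    = (\<Sum>x\<leftarrow>xs. g x) + (\<Sum>x\<leftarrow>ys. g x)"
proof -
  have "(\<Sum>x\<leftarrow>take n zs. g x) + (\<Sum>x\<leftarrow>drop n zs. g x) = (\<Sum>x\<leftarrow>zs. g x)" for n zs
    by (metis append_take_drop_id map_append sum_list_append)
  from this[of "crossover_point \<Delta> s xs ys" xs] this[of "crossover_point \<Delta> s xs ys + s" ys] show ?thesis
    by (simp add: crossover_def cocrossover_def add_ac flip: add.assoc)
qed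

subsection \<open>Chains of maximal weight\<close>

definition max_sep_list :: "nat \<Rightarrow> nat \<Rightarrow> (nat \<Rightarrow> int) \<Rightarrow> nat list \<Rightarrow> bool" where
  "max_sep_list \<Delta> d g xs \<longleftrightarrow> is_arg_max (\<lambda>ys. \<Sum>y\<leftarrow>ys. g y) (sep_list \<Delta> d) xs"

lemma max_sep_listI:
  "sep_list \<Delta> d xs \<Longrightarrow> (\<And>ys. sep_list \<Delta> d ys \<Longrightarrow> (\<Sum>y\<leftarrow>ys. g y) \<le> (\<Sum>x\<leftarrow>xs. g x)) \<Longrightarrow> max_sep_list \<Delta> d g xs"
  by (simp add: max_sep_list_def is_arg_max_linorder)

lemma max_sep_list_imp_sep_list: "max_sep_list \<Delta> d g xs \<Longrightarrow> sep_list \<Delta> d xs"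
  by (simp add: max_sep_list_def is_arg_max_linorder)

lemma max_sep_list_ge: "max_sep_list \<Delta> d g xs \<Longrightarrow> sep_list \<Delta> d ys \<Longrightarrow> (\<Sum>y\<leftarrow>ys. g y) \<le> (\<Sum>x\<leftarrow>xs. g x)"
  by (simp add: max_sep_list_def is_arg_max_linorder)

lemma sep_list_step_towards:
  fixes g :: "nat \<Rightarrow> int"
  assumes xs: "sep_list \<Delta> d xs" and ys: "sep_list \<Delta> d ys"
    and far: "1 < \<bar>int (length ys) - int (length xs)\<bar>"
  obtains us vs where "sep_list \<Delta> d us" "sep_list \<Delta> d vs"
    "\<bar>int (length us) - int (length xs)\<bar> = 1"
    "\<bar>int (length vs) - int (length xs)\<bar> < \<bar>int (length ys) - int (length xs)\<bar>"
    "(\<Sum>u\<leftarrow>us. g u) + (\<Sum>v\<leftarrow>vs. g v) = (\<Sum>x\<leftarrow>xs. g x) + (\<Sum>y\<leftarrow>ys. g y)"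
proof -
  consider (longer) "length xs + 2 \<le> length ys" | (shorter) "length ys + 2 \<le> length xs"
    using far by linarith
  then show thesis
  proof cases
    case longer
    then have len: "length xs + 1 \<le> length ys" by simp
    show thesis
      using longer sep_list_crossover[OF xs ys] sep_list_cocrossover[OF xs ys len]
        length_crossover[OF len] length_cocrossover[OF len] sum_list_crossover[of g \<Delta> 1 xs ys]
      by (intro that[of "cocrossover \<Delta> 1 xs ys" "crossover \<Delta> 1 xs ys"]) (simp_all add: add.commute)
  next
    case shorter
    then have len: "length ys + 1 \<le> length xs" by simp
    show thesis
      using shorter sep_list_crossover[OF ys xs] sep_list_cocrossover[OF ys xs len]
        length_crossover[OF len] length_cocrossover[OF len] sum_list_crossover[of g \<Delta> 1 ys xs]
      by (intro that[of "crossover \<Delta> 1 ys xs" "cocrossover \<Delta> 1 ys xs"]) (simp_all add: add.commute)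
  qed
qed

text \<open>By crossover, the maximal weight is a concave function of the length.\<close>

lemma max_sep_list_if_locally_max:
  assumes xs: "sep_list \<Delta> d xs"
    and local: "\<And>ys. sep_list \<Delta> d ys \<Longrightarrow> \<bar>int (length ys) - int (length xs)\<bar> \<le> 1 \<Longrightarrow>
      (\<Sum>y\<leftarrow>ys. g y) \<le> (\<Sum>x\<leftarrow>xs. g x)"
  shows "max_sep_list \<Delta> d g xs"
proof (rule max_sep_listI[OF xs])
  fix ys assume "sep_list \<Delta> d ys"
  then show "(\<Sum>y\<leftarrow>ys. g y) \<le> (\<Sum>x\<leftarrow>xs. g x)"
  proof (induction "nat \<bar>int (length ys) - int (length xs)\<bar>" arbitrary: ys rule: less_induct)
    case less
    show ?case
    proof (cases "\<bar>int (length ys) - int (length xs)\<bar> \<le> 1")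
      case False
      then obtain us vs where us: "sep_list \<Delta> d us" "\<bar>int (length us) - int (length xs)\<bar> = 1"
        and vs: "sep_list \<Delta> d vs"
          "\<bar>int (length vs) - int (length xs)\<bar> < \<bar>int (length ys) - int (length xs)\<bar>"
        and sum: "(\<Sum>u\<leftarrow>us. g u) + (\<Sum>v\<leftarrow>vs. g v) = (\<Sum>x\<leftarrow>xs. g x) + (\<Sum>y\<leftarrow>ys. g y)"
        using sep_list_step_towards[OF xs less.prems] by (metis not_le)
      have "(\<Sum>u\<leftarrow>us. g u) \<le> (\<Sum>x\<leftarrow>xs. g x)" using us by (intro local) auto
      moreover have "(\<Sum>v\<leftarrow>vs. g v) \<le> (\<Sum>x\<leftarrow>xs. g x)" using vs by (intro less.hyps) auto
      ultimately show ?thesis using sum by simp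
    qed (use local less.prems in simp)
  qed
qed

lemma max_sep_list_crossover:
  assumes xs: "max_sep_list \<Delta> d g xs" and ys: "max_sep_list \<Delta> d g ys"
    and len: "length xs + s \<le> length ys"
  shows "max_sep_list \<Delta> d g (crossover \<Delta> s xs ys)"
proof (rule max_sep_listI)
  note chains = max_sep_list_imp_sep_list[OF xs] max_sep_list_imp_sep_list[OF ys]
  show "sep_list \<Delta> d (crossover \<Delta> s xs ys)" by (rule sep_list_crossover[OF chains])
  fix zs assume zs: "sep_list \<Delta> d zs"
  have "(\<Sum>z\<leftarrow>cocrossover \<Delta> s xs ys. g z) \<le> (\<Sum>x\<leftarrow>xs. g x)"
    by (rule max_sep_list_ge[OF xs sep_list_cocrossover[OF chains len]])
  then have "(\<Sum>y\<leftarrow>ys. g y) \<le> (\<Sum>z\<leftarrow>crossover \<Delta> s xs ys. g z)"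
    using sum_list_crossover[of g \<Delta> s xs ys] by simp
  with max_sep_list_ge[OF ys zs] show "(\<Sum>z\<leftarrow>zs. g z) \<le> (\<Sum>z\<leftarrow>crossover \<Delta> s xs ys. g z)" by simp
qed

subsection \<open>Lagrange multipliers\<close>

lemma sum_list_penalized:
  fixes f :: "'a \<Rightarrow> int"
  shows "(\<Sum>x\<leftarrow>xs. f x - \<mu>) = (\<Sum>x\<leftarrow>xs. f x) - \<mu> * int (length xs)"
  by (induction xs) (simp_all add: algebra_simps)

lemma max_sep_list_adjacent_multiplier:
  assumes even: "\<And>i. even (f i)" "even \<mu>" and \<nu>: "\<bar>\<nu> - \<mu>\<bar> = 1"
    and xs: "max_sep_list \<Delta> d (\<lambda>i. f i - \<nu>) xs"
  shows "max_sep_list \<Delta> d (\<lambda>i. f i - \<mu>) xs"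
proof (rule max_sep_list_if_locally_max[OF max_sep_list_imp_sep_list[OF xs]])
  fix ys assume ys: "sep_list \<Delta> d ys" and near: "\<bar>int (length ys) - int (length xs)\<bar> \<le> 1"
  have "(\<Sum>y\<leftarrow>ys. f y - \<mu>) \<le> (\<Sum>x\<leftarrow>xs. f x - \<mu>) + (\<nu> - \<mu>) * (int (length ys) - int (length xs))"
    using max_sep_list_ge[OF xs ys] by (simp add: sum_list_penalized algebra_simps)
  also have "(\<nu> - \<mu>) * (int (length ys) - int (length xs)) \<le> 1"
    using abs_ge_self[of "(\<nu> - \<mu>) * (int (length ys) - int (length xs))"] \<nu> near
    by (simp add: abs_mult)
  finally have "(\<Sum>y\<leftarrow>ys. f y - \<mu>) \<le> (\<Sum>x\<leftarrow>xs. f x - \<mu>) + 1" by simp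
  moreover have "even (\<Sum>z\<leftarrow>zs. f z - \<mu>)" for zs
    by (induction zs) (simp_all add: even)
  then have "even (\<Sum>y\<leftarrow>ys. f y - \<mu>)" "even (\<Sum>x\<leftarrow>xs. f x - \<mu>)" by blast+
  ultimately show "(\<Sum>y\<leftarrow>ys. f y - \<mu>) \<le> (\<Sum>x\<leftarrow>xs. f x - \<mu>)" by presburger
qed

lemma max_sep_list_crossover_weight_ge:
  assumes even: "\<And>i. even (f i)" "even \<mu>"
    and xs: "max_sep_list \<Delta> d (\<lambda>i. f i - (\<mu> + 1)) xs" and ys: "max_sep_list \<Delta> d (\<lambda>i. f i - (\<mu> - 1)) ys"
    and len: "length xs \<le> k" "k \<le> length ys" and zs: "sep_list \<Delta> d zs" "length zs = k"
  shows "(\<Sum>z\<leftarrow>zs. f z) \<le> (\<Sum>u\<leftarrow>crossover \<Delta> (length ys - k) xs ys. f u)"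
proof -
  let ?us = "crossover \<Delta> (length ys - k) xs ys"
  have len': "length xs + (length ys - k) \<le> length ys" using len by simp
  have "max_sep_list \<Delta> d (\<lambda>i. f i - \<mu>) xs" "max_sep_list \<Delta> d (\<lambda>i. f i - \<mu>) ys"
    using max_sep_list_adjacent_multiplier[OF even _ xs] max_sep_list_adjacent_multiplier[OF even _ ys]
    by simp_all
  from max_sep_list_ge[OF max_sep_list_crossover[OF this len'] zs(1)]
  have "(\<Sum>z\<leftarrow>zs. f z) - \<mu> * int (length zs) \<le> (\<Sum>u\<leftarrow>?us. f u) - \<mu> * int (length ?us)"
    by (simp add: sum_list_penalized)
  then show ?thesis using length_crossover[OF len'] len(2) zs(2) by simp
qed

lemma max_sep_list_negative_weights:
  assumes neg: "\<And>i. i \<in> {1..d} \<Longrightarrow> g i < 0" and xs: "max_sep_list \<Delta> d g xs"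
  shows "xs = []"
proof (rule ccontr)
  assume "xs \<noteq> []"
  then have "(\<Sum>x\<leftarrow>xs. g x) < (\<Sum>x\<leftarrow>xs. 0)"
    using neg sep_list_set_subset[OF max_sep_list_imp_sep_list[OF xs]]
    by (intro sum_list_strict_mono) auto
  with max_sep_list_ge[OF xs sep_list_Nil] show False by simp
qed

lemma length_max_sep_list_ge:
  assumes f: "\<And>i. i \<in> {1..d} \<Longrightarrow> 0 \<le> f i \<and> f i \<le> M" and \<mu>: "\<mu> < - (M * int k)"
    and xs: "max_sep_list \<Delta> d (\<lambda>i. f i - \<mu>) xs" and ys: "sep_list \<Delta> d ys" "length ys = k" and "0 \<le> M"
  shows "k \<le> length xs"
proof (rule ccontr)
  assume "\<not> k \<le> length xs"
  then have short: "int (length xs) + 1 \<le> int k" by simp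
  have nonneg: "0 \<le> M * int k" using \<open>0 \<le> M\<close> by simp
  have "(\<Sum>x\<leftarrow>xs. f x) \<le> (\<Sum>x\<leftarrow>xs. M)"
    using f sep_list_set_subset[OF max_sep_list_imp_sep_list[OF xs]] by (intro sum_list_mono) auto
  also have "\<dots> = M * int (length xs)" by (simp add: sum_list_triv)
  also have "\<dots> \<le> M * int k" using short \<open>0 \<le> M\<close> by (intro mult_left_mono) auto
  also have "\<dots> < - \<mu> * 1" using \<mu> by simp
  also have "\<dots> \<le> - \<mu> * (int k - int (length xs))"
    using short \<mu> nonneg by (intro mult_left_mono) linarith+
  finally have "(\<Sum>x\<leftarrow>xs. f x) - \<mu> * int (length xs) < - \<mu> * int k" by (simp add: algebra_simps)
  moreover have "0 \<le> (\<Sum>y\<leftarrow>ys. f y)"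
    using f sep_list_set_subset[OF ys(1)] by (intro sum_list_nonneg) auto
  ultimately show False
    using max_sep_list_ge[OF xs ys(1)] ys(2) by (simp add: sum_list_penalized)
qed

subsection \<open>Dynamic programming\<close>

text \<open>Writing \<open>i - (\<Delta> - 1)\<close> for \<open>Suc i - \<Delta>\<close> makes the recursion terminate for \<open>\<Delta> = 0\<close>.\<close>

fun dp_value :: "nat \<Rightarrow> (nat \<Rightarrow> int) \<Rightarrow> nat \<Rightarrow> int" where
  "dp_value \<Delta> g 0 = 0"
| "dp_value \<Delta> g (Suc i) = max (dp_value \<Delta> g i) (dp_value \<Delta> g (i - (\<Delta> - 1)) + g (Suc i))"

fun dp_list :: "nat \<Rightarrow> (nat \<Rightarrow> int) \<Rightarrow> nat \<Rightarrow> nat list" where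
  "dp_list \<Delta> g 0 = []"
| "dp_list \<Delta> g (Suc i) =
     (if dp_value \<Delta> g i < dp_value \<Delta> g (Suc i) then Suc i # dp_list \<Delta> g (i - (\<Delta> - 1))
      else dp_list \<Delta> g i)"

declare dp_value.simps(2) [simp del] dp_list.simps(2) [simp del]

lemma dp_value_Suc:
  "1 \<le> \<Delta> \<Longrightarrow> dp_value \<Delta> g (Suc i) = max (dp_value \<Delta> g i) (dp_value \<Delta> g (Suc i - \<Delta>) + g (Suc i))"
  by (cases \<Delta>) (simp_all add: dp_value.simps(2))

lemma dp_list_Suc:
  "1 \<le> \<Delta> \<Longrightarrow> dp_list \<Delta> g (Suc i) =
     (if dp_value \<Delta> g i < dp_value \<Delta> g (Suc i) then Suc i # dp_list \<Delta> g (Suc i - \<Delta>) else dp_list \<Delta> g i)"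
  by (cases \<Delta>) (simp_all add: dp_list.simps(2))

lemma dp_value_nonneg: "0 \<le> dp_value \<Delta> g i"
  by (induction i) (auto simp: dp_value.simps(2))

lemma dp_value_le:
  assumes "\<And>j. j \<in> {1..i} \<Longrightarrow> g j \<le> M" "0 \<le> M"
  shows "dp_value \<Delta> g i \<le> int i * M"
  using assms(1)
proof (induction i rule: less_induct)
  case (less i)
  show ?case
  proof (cases i)
    case (Suc j)
    have "dp_value \<Delta> g (j - (\<Delta> - 1)) \<le> int (j - (\<Delta> - 1)) * M" using less Suc by auto
    also have "\<dots> \<le> int j * M" using assms(2) by (intro mult_right_mono) auto
    finally have "dp_value \<Delta> g (j - (\<Delta> - 1)) \<le> int j * M" .
    moreover have "dp_value \<Delta> g j \<le> int j * M" "g (Suc j) \<le> M" using less Suc by auto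
    ultimately show ?thesis using assms(2) by (simp add: Suc dp_value.simps(2) algebra_simps)
  qed simp
qed

lemma sum_list_le_dp_value:
  assumes "sep_list \<Delta> i xs" "1 \<le> \<Delta>"
  shows "(\<Sum>x\<leftarrow>xs. g x) \<le> dp_value \<Delta> g i"
  using assms(1)
proof (induction i arbitrary: xs rule: less_induct)
  case (less i)
  show ?case
  proof (cases xs)
    case Nil
    then show ?thesis by (simp add: dp_value_nonneg)
  next
    case (Cons y ys)
    with less.prems obtain j where i: "i = Suc j" and y: "y \<le> Suc j"
      and gap: "\<forall>z\<in>set ys. z + \<Delta> \<le> y" and ys: "sep_list \<Delta> i ys"
      by (cases i) (auto simp: sep_list_Cons)
    show ?thesis
    proof (cases "y = Suc j")
      case True
      have "sep_list \<Delta> (Suc j - \<Delta>) ys"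
        by (rule sep_list_restrict[OF ys]) (use gap True in fastforce)
      then have "(\<Sum>z\<leftarrow>ys. g z) \<le> dp_value \<Delta> g (Suc j - \<Delta>)"
        using \<open>1 \<le> \<Delta>\<close> by (intro less.IH) (simp_all add: i)
      then show ?thesis by (simp add: i Cons True dp_value_Suc[OF \<open>1 \<le> \<Delta>\<close>])
    next
      case False
      have "sep_list \<Delta> j xs"
        using sep_list_restrict[OF less.prems, of j] gap y False \<open>1 \<le> \<Delta>\<close> by (fastforce simp: Cons)
      then have "(\<Sum>x\<leftarrow>xs. g x) \<le> dp_value \<Delta> g j" by (intro less.IH) (simp_all add: i)
      then show ?thesis by (simp add: i dp_value_Suc[OF \<open>1 \<le> \<Delta>\<close>])
    qed
  qed
qed

lemma sep_list_dp_list_sum: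
  assumes "1 \<le> \<Delta>"
  shows "sep_list \<Delta> i (dp_list \<Delta> g i) \<and> (\<Sum>x\<leftarrow>dp_list \<Delta> g i. g x) = dp_value \<Delta> g i"
proof (induction i rule: less_induct)
  case (less i)
  show ?case
  proof (cases i)
    case (Suc j)
    have skip: "sep_list \<Delta> j (dp_list \<Delta> g j)" "(\<Sum>x\<leftarrow>dp_list \<Delta> g j. g x) = dp_value \<Delta> g j"
      and take: "sep_list \<Delta> (Suc j - \<Delta>) (dp_list \<Delta> g (Suc j - \<Delta>))"
        "(\<Sum>x\<leftarrow>dp_list \<Delta> g (Suc j - \<Delta>). g x) = dp_value \<Delta> g (Suc j - \<Delta>)"
      using less Suc assms by auto
    have "\<forall>y\<in>set (dp_list \<Delta> g (Suc j - \<Delta>)). y + \<Delta> \<le> Suc j"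
      using sep_list_set_subset[OF take(1)] by fastforce
    then show ?thesis
      using skip take sep_list_mono[OF skip(1), of "Suc j"] sep_list_mono[OF take(1), of "Suc j"]
      by (auto simp: Suc dp_list_Suc[OF assms] dp_value_Suc[OF assms] sep_list_Cons)
  qed simp
qed

lemma max_sep_list_dp_list: "1 \<le> \<Delta> \<Longrightarrow> max_sep_list \<Delta> d g (dp_list \<Delta> g d)"
  using sep_list_dp_list_sum sum_list_le_dp_value by (auto intro!: max_sep_listI)

subsection \<open>Relaxed optima with odd multipliers\<close>

definition relaxed :: "nat \<Rightarrow> nat \<Rightarrow> (nat \<Rightarrow> int) \<Rightarrow> int \<Rightarrow> nat list" where
  "relaxed \<Delta> d f v = dp_list \<Delta> (\<lambda>i. f i - (2 * v + 1)) d"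

lemma max_sep_list_relaxed: "1 \<le> \<Delta> \<Longrightarrow> max_sep_list \<Delta> d (\<lambda>i. f i - (2 * v + 1)) (relaxed \<Delta> d f v)"
  unfolding relaxed_def by (rule max_sep_list_dp_list)

lemma sep_list_relaxed: "1 \<le> \<Delta> \<Longrightarrow> sep_list \<Delta> d (relaxed \<Delta> d f v)"
  using max_sep_list_relaxed max_sep_list_imp_sep_list by blast

lemma length_relaxed_le: "1 \<le> \<Delta> \<Longrightarrow> length (relaxed \<Delta> d f v) \<le> d"
  using sep_list_relaxed length_sep_list_le by blast

lemma max_weight_crossover_relaxed:
  fixes d :: nat and f :: "nat \<Rightarrow> int" and l :: int
  assumes even: "\<And>i. even (f i)" and \<Delta>: "1 \<le> \<Delta>"
  defines "xs \<equiv> relaxed \<Delta> d f (l + 1)" and "ys \<equiv> relaxed \<Delta> d f l"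
  assumes len: "length xs \<le> k" "k \<le> length ys"
  shows "is_arg_max (sum f) (\<lambda>\<Omega>. \<Omega> \<in> sep_sets_card d k \<Delta>) (set (crossover \<Delta> (length ys - k) xs ys))"
proof -
  let ?us = "crossover \<Delta> (length ys - k) xs ys"
  have xs: "max_sep_list \<Delta> d (\<lambda>i. f i - (2 * (l + 1) + 1)) xs"
    and ys: "max_sep_list \<Delta> d (\<lambda>i. f i - (2 * (l + 1) - 1)) ys"
    using max_sep_list_relaxed[OF \<Delta>, of d f "l + 1"] max_sep_list_relaxed[OF \<Delta>, of d f l]
    by (simp_all add: xs_def ys_def algebra_simps)
  have us: "sep_list \<Delta> d ?us" "length ?us = k"
    using sep_list_crossover[OF xs[THEN max_sep_list_imp_sep_list] ys[THEN max_sep_list_imp_sep_list]]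
      length_crossover[of xs "length ys - k" ys] len by simp_all
  have sum: "(\<Sum>z\<leftarrow>zs. f z) = sum f (set zs)" if "sep_list \<Delta> d zs" for zs
    by (rule sum_list_distinct_conv_sum_set[OF distinct_sep_list[OF that \<Delta>]])
  have "sum f \<Omega> \<le> sum f (set ?us)" if \<Omega>: "\<Omega> \<in> sep_sets_card d k \<Delta>" for \<Omega>
  proof -
    obtain zs where zs: "sep_list \<Delta> d zs" "length zs = k" "set zs = \<Omega>"
      by (rule sep_sets_card_obtain_sep_list[OF \<Omega>])
    show ?thesis
      using max_sep_list_crossover_weight_ge[OF even _ xs ys len zs(1,2)]
        sum[OF us(1)] sum[OF zs(1)] zs(3)
      by simp
  qed
  with set_sep_list_in_sep_sets_card[OF us(1) \<Delta>] us(2) show ?thesis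
    by (simp add: is_arg_max_linorder)
qed

section \<open>Projection and maximal weight\<close>

subsection \<open>Optimal supports\<close>

definition sq_dist :: "nat \<Rightarrow> (nat \<Rightarrow> real) \<Rightarrow> (nat \<Rightarrow> real) \<Rightarrow> real" where
  "sq_dist d x y = (\<Sum>i\<in>{1..d}. (x i - y i)\<^sup>2)"

definition energy :: "(nat \<Rightarrow> real) \<Rightarrow> nat set \<Rightarrow> real" where
  "energy x \<Omega> = (\<Sum>i\<in>\<Omega>. (x i)\<^sup>2)"

lemma is_arg_min_l2_dist_iff:
  "is_arg_min (l2_dist d x) P y \<longleftrightarrow> P y \<and> (\<forall>z. P z \<longrightarrow> sq_dist d x y \<le> sq_dist d x z)"
  by (simp add: is_arg_min_linorder l2_dist_def L2_set_def sq_dist_def)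

lemma supp_subset: "supp d y \<subseteq> {1..d}"
  by (auto simp: supp_def)

lemma sq_dist_ge_energy_diff:
  assumes "supp d y \<subseteq> \<Omega>" "\<Omega> \<subseteq> {1..d}"
  shows "energy x {1..d} - energy x \<Omega> \<le> sq_dist d x y"
proof -
  have "energy x {1..d} - energy x \<Omega> = (\<Sum>i\<in>{1..d} - \<Omega>. (x i)\<^sup>2)"
    using assms(2) by (simp add: energy_def sum_diff)
  also have "\<dots> = (\<Sum>i\<in>{1..d} - \<Omega>. (x i - y i)\<^sup>2)"
    using assms(1) by (intro sum.cong) (auto simp: supp_def)
  also have "\<dots> \<le> sq_dist d x y"
    unfolding sq_dist_def by (intro sum_mono2) auto
  finally show ?thesis .
qed

lemma sq_dist_le_energy_diff:
  assumes "\<Omega> \<subseteq> {1..d}" "\<And>i. i \<in> \<Omega> \<Longrightarrow> \<bar>x i - y i\<bar> \<le> \<epsilon>" "\<And>i. i \<in> {1..d} - \<Omega> \<Longrightarrow> y i = 0"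
  shows "sq_dist d x y \<le> energy x {1..d} - energy x \<Omega> + real (card \<Omega>) * \<epsilon>\<^sup>2"
proof -
  have "sq_dist d x y = (\<Sum>i\<in>{1..d} - \<Omega>. (x i - y i)\<^sup>2) + (\<Sum>i\<in>\<Omega>. (x i - y i)\<^sup>2)"
    unfolding sq_dist_def using assms(1) by (simp add: sum.subset_diff)
  also have "(\<Sum>i\<in>{1..d} - \<Omega>. (x i - y i)\<^sup>2) = (\<Sum>i\<in>{1..d} - \<Omega>. (x i)\<^sup>2)"
    using assms(3) by (intro sum.cong) auto
  also have "\<dots> = energy x {1..d} - energy x \<Omega>"
    using assms(1) by (simp add: energy_def sum_diff)
  also have "(\<Sum>i\<in>\<Omega>. (x i - y i)\<^sup>2) \<le> (\<Sum>i\<in>\<Omega>. \<epsilon>\<^sup>2)"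
    using assms(2) by (intro sum_mono) (force simp flip: abs_le_square_iff)
  finally show ?thesis by simp
qed

lemma restriction_arg_min:
  assumes F: "\<And>\<Omega>. \<Omega> \<in> F \<Longrightarrow> \<Omega> \<subseteq> {1..d}" and max: "is_arg_max (energy x) (\<lambda>\<Omega>. \<Omega> \<in> F) \<Omega>"
    and y: "\<And>i. i \<in> {1..d} \<Longrightarrow> y i = (if i \<in> \<Omega> then x i else 0)"
  shows "is_arg_min (l2_dist d x) (\<lambda>x'. \<exists>\<Omega>\<in>F. supp d x' \<subseteq> \<Omega>) y"
    and "(\<And>i. i \<in> \<Omega> \<Longrightarrow> x i \<noteq> 0) \<Longrightarrow> is_arg_min (l2_dist d x) (\<lambda>x'. supp d x' \<in> F) y"
proof -
  have \<Omega>: "\<Omega> \<in> F" "\<Omega> \<subseteq> {1..d}" using F max by (auto simp: is_arg_max_linorder)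
  have energy: "energy x \<Omega>' \<le> energy x \<Omega>" if "\<Omega>' \<in> F" for \<Omega>'
    using max that by (simp add: is_arg_max_linorder)
  have "\<bar>x i - y i\<bar> \<le> 0" if "i \<in> \<Omega>" for i using y[of i] \<Omega>(2) that by auto
  from sq_dist_le_energy_diff[OF \<Omega>(2) this] have "sq_dist d x y \<le> energy x {1..d} - energy x \<Omega>"
    using y by simp
  then have le: "sq_dist d x y \<le> sq_dist d x z" if "\<Omega>' \<in> F" "supp d z \<subseteq> \<Omega>'" for z \<Omega>'
    using sq_dist_ge_energy_diff[OF that(2) F[OF that(1)], of x] energy[OF that(1)] by linarith
  have "supp d y \<subseteq> \<Omega>" using y by (auto simp: supp_def split: if_splits)
  with \<Omega>(1) le show "is_arg_min (l2_dist d x) (\<lambda>x'. \<exists>\<Omega>\<in>F. supp d x' \<subseteq> \<Omega>) y"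
    unfolding is_arg_min_l2_dist_iff by blast
  assume "\<And>i. i \<in> \<Omega> \<Longrightarrow> x i \<noteq> 0"
  then have "supp d y = \<Omega>" using y \<Omega>(2) by (auto simp: supp_def split: if_splits)
  with \<Omega>(1) le show "is_arg_min (l2_dist d x) (\<lambda>x'. supp d x' \<in> F) y"
    unfolding is_arg_min_l2_dist_iff by blast
qed

lemma arg_min_exact_support_nonzero:
  assumes z: "is_arg_min (l2_dist d x) (\<lambda>x'. supp d x' \<in> F) z" and i: "i \<in> supp d z"
  shows "x i \<noteq> 0"
proof
  assume "x i = 0"
  let ?y = "z(i := z i / 2)"
  have i': "i \<in> {1..d}" "z i \<noteq> 0" using i by (auto simp: supp_def)
  have "supp d ?y = supp d z" using i' by (auto simp: supp_def)
  then have "sq_dist d x z \<le> sq_dist d x ?y" using z by (simp add: is_arg_min_l2_dist_iff)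
  moreover have "sq_dist d x ?y < sq_dist d x z"
    unfolding sq_dist_def
  proof (rule sum_strict_mono_ex1)
    have less: "(z i / 2)\<^sup>2 < (z i)\<^sup>2" using i' by (simp add: power_divide)
    then show "\<forall>j\<in>{1..d}. (x j - ?y j)\<^sup>2 \<le> (x j - z j)\<^sup>2" using \<open>x i = 0\<close> by auto
    show "\<exists>j\<in>{1..d}. (x j - ?y j)\<^sup>2 < (x j - z j)\<^sup>2"
      using less i' \<open>x i = 0\<close> by (intro bexI[of _ i]) auto
  qed simp
  ultimately show False by simp
qed

text \<open>
  A vector with support exactly \<open>\<Omega>\<close> may have to be nonzero where \<open>x\<close> vanishes, so the distance
  \<open>energy x {1..d} - energy x \<Omega>\<close> is only approached.
\<close>

lemma arg_min_exact_support_energy: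
  assumes F: "\<And>\<Omega>. \<Omega> \<in> F \<Longrightarrow> \<Omega> \<subseteq> {1..d}"
    and z: "is_arg_min (l2_dist d x) (\<lambda>x'. supp d x' \<in> F) z"
  shows "is_arg_max (energy x) (\<lambda>\<Omega>. \<Omega> \<in> F) (supp d z)"
proof -
  have supp: "supp d z \<in> F" using z by (simp add: is_arg_min_l2_dist_iff)
  have "energy x \<Omega> \<le> energy x (supp d z)" if \<Omega>: "\<Omega> \<in> F" for \<Omega>
  proof -
    have "sq_dist d x z \<le> energy x {1..d} - energy x \<Omega>"
    proof (rule field_le_epsilon)
      fix \<delta> :: real assume "0 < \<delta>"
      define \<epsilon> where "\<epsilon> = sqrt (\<delta> / (real (card \<Omega>) + 1))"
      have "0 < \<epsilon>" using \<open>0 < \<delta>\<close> by (simp add: \<epsilon>_def)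
      let ?y = "\<lambda>i. if i \<in> \<Omega> then (if x i = 0 then \<epsilon> else x i) else 0"
      have "supp d ?y = \<Omega>" using F[OF \<Omega>] \<open>0 < \<epsilon>\<close> by (auto simp: supp_def)
      then have "sq_dist d x z \<le> sq_dist d x ?y" using z \<Omega> by (simp add: is_arg_min_l2_dist_iff)
      also have "\<dots> \<le> energy x {1..d} - energy x \<Omega> + real (card \<Omega>) * \<epsilon>\<^sup>2"
        using \<open>0 < \<epsilon>\<close> by (intro sq_dist_le_energy_diff F[OF \<Omega>]) auto
      also have "real (card \<Omega>) * \<epsilon>\<^sup>2 \<le> \<delta>"
        using \<open>0 < \<delta>\<close> by (simp add: \<epsilon>_def field_simps)
      finally show "sq_dist d x z \<le> energy x {1..d} - energy x \<Omega> + \<delta>" by simp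
    qed
    with sq_dist_ge_energy_diff[OF order_refl supp_subset, of x d z] show ?thesis by simp
  qed
  with supp show ?thesis by (simp add: is_arg_max_linorder)
qed

subsection \<open>Integer weights\<close>

text \<open>
  The weight orders the \<open>k\<close>-element sets by energy first and by the number of nonzero coefficients
  second. The second criterion makes the support of the output as large as possible, which matters
  for the problem with support of size exactly \<open>k\<close>. The factor 2 makes all weights even.
\<close>

definition weight :: "nat \<Rightarrow> (nat \<Rightarrow> int) \<Rightarrow> nat \<Rightarrow> int" where
  "weight k m i = 2 * ((int k + 1) * (m i)\<^sup>2 + of_bool (m i \<noteq> 0))"

lemma even_weight: "even (weight k m i)"
  by (simp add: weight_def)

lemma sum_weight:
  assumes "finite \<Omega>"
  shows "(\<Sum>i\<in>\<Omega>. weight k m i) =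
    2 * ((int k + 1) * (\<Sum>i\<in>\<Omega>. (m i)\<^sup>2) + int (card {i\<in>\<Omega>. m i \<noteq> 0}))"
proof -
  have "(\<Sum>i\<in>\<Omega>. of_bool (m i \<noteq> 0) :: int) = int (card {i\<in>\<Omega>. m i \<noteq> 0})"
    using assms by (simp add: Int_def)
  then show ?thesis by (simp add: weight_def sum.distrib flip: sum_distrib_left)
qed

lemma weight_lexicographic:
  assumes fin: "finite \<Omega>" "finite \<Omega>'" and card: "card \<Omega> = k" "card \<Omega>' = k"
    and le: "(\<Sum>i\<in>\<Omega>'. weight k m i) \<le> (\<Sum>i\<in>\<Omega>. weight k m i)"
  shows "(\<Sum>i\<in>\<Omega>'. (m i)\<^sup>2) \<le> (\<Sum>i\<in>\<Omega>. (m i)\<^sup>2)" (is "?b \<le> ?a")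
    and "(\<Sum>i\<in>\<Omega>. (m i)\<^sup>2) \<le> (\<Sum>i\<in>\<Omega>'. (m i)\<^sup>2) \<Longrightarrow> \<forall>i\<in>\<Omega>'. m i \<noteq> 0 \<Longrightarrow> \<forall>i\<in>\<Omega>. m i \<noteq> 0"
proof -
  let ?p = "card {i\<in>\<Omega>. m i \<noteq> 0}" and ?q = "card {i\<in>\<Omega>'. m i \<noteq> 0}"
  have p: "?p \<le> k" using fin(1) card(1) by (auto intro: card_mono)
  have le': "(int k + 1) * ?b + int ?q \<le> (int k + 1) * ?a + int ?p"
    using le fin by (simp add: sum_weight)
  then have "(int k + 1) * (?b - ?a) < (int k + 1) * 1"
    using p by (simp add: right_diff_distrib)
  then have "?b - ?a < 1" by (subst (asm) mult_less_cancel_left_pos) auto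
  then show ba: "?b \<le> ?a" by simp
  assume "?a \<le> ?b" and nonzero: "\<forall>i\<in>\<Omega>'. m i \<noteq> 0"
  then have "?q \<le> ?p" using ba le' by simp
  moreover have "{i\<in>\<Omega>'. m i \<noteq> 0} = \<Omega>'" using nonzero by auto
  ultimately have "card \<Omega> \<le> ?p" using card by simp
  then have "{i\<in>\<Omega>. m i \<noteq> 0} = \<Omega>" using fin by (intro card_seteq) auto
  then show "\<forall>i\<in>\<Omega>. m i \<noteq> 0" by blast
qed

lemma energy_decode:
  assumes "\<And>i. i \<in> \<Omega> \<Longrightarrow> x i = decode e m i"
  shows "energy x \<Omega> = (2 powi e)\<^sup>2 * of_int (\<Sum>i\<in>\<Omega>. (m i)\<^sup>2)"
  using assms by (simp add: energy_def decode_def power_mult_distrib sum_distrib_left mult.commute)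

definition max_weight_restriction :: "nat \<Rightarrow> nat \<Rightarrow> nat \<Rightarrow> (nat \<Rightarrow> int) \<Rightarrow> (nat \<Rightarrow> int) \<Rightarrow> bool" where
  "max_weight_restriction d k \<Delta> m A \<longleftrightarrow>
     (\<exists>\<Omega>. is_arg_max (sum (weight k m)) (\<lambda>\<Omega>. \<Omega> \<in> sep_sets_card d k \<Delta>) \<Omega> \<and>
       A = (\<lambda>i. if i \<in> \<Omega> then m i else 0))"

lemma arg_min_decode_max_weight_restriction:
  assumes x: "\<And>i. i \<in> {1..d} \<Longrightarrow> x i = decode e m i" and A: "max_weight_restriction d k \<Delta> m A"
  shows "is_arg_min (l2_dist d x) (\<lambda>x'. \<exists>\<Omega>\<in>sep_sets_card d k \<Delta>. supp d x' \<subseteq> \<Omega>) (decode e A)"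
    and "is_arg_min (l2_dist d x) (\<lambda>x'. supp d x' \<in> sep_sets_card d k \<Delta>) z \<Longrightarrow>
      is_arg_min (l2_dist d x) (\<lambda>x'. supp d x' \<in> sep_sets_card d k \<Delta>) (decode e A)"
proof -
  let ?F = "sep_sets_card d k \<Delta>"
  obtain \<Omega> where max: "is_arg_max (sum (weight k m)) (\<lambda>\<Omega>. \<Omega> \<in> ?F) \<Omega>"
    and A_eq: "A = (\<lambda>i. if i \<in> \<Omega> then m i else 0)"
    using A by (auto simp: max_weight_restriction_def)
  have F: "\<Omega>' \<subseteq> {1..d}" "finite \<Omega>'" "card \<Omega>' = k" if "\<Omega>' \<in> ?F" for \<Omega>'
    using that finite_subset[of \<Omega>' "{1..d}"] by (auto simp: sep_sets_card_def sep_sets_def)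
  have energy_le: "energy x \<Omega>' \<le> energy x \<Omega>'' \<longleftrightarrow> (\<Sum>i\<in>\<Omega>'. (m i)\<^sup>2) \<le> (\<Sum>i\<in>\<Omega>''. (m i)\<^sup>2)"
    if "\<Omega>' \<in> ?F" "\<Omega>'' \<in> ?F" for \<Omega>' \<Omega>''
  proof -
    have "energy x T = (2 powi e)\<^sup>2 * of_int (\<Sum>i\<in>T. (m i)\<^sup>2)" if "T \<in> ?F" for T
      using x F(1)[OF that] by (intro energy_decode) blast
    with that show ?thesis by (simp add: mult_le_cancel_left_pos del: of_int_sum)
  qed
  have \<Omega>: "\<Omega> \<in> ?F" using max by (simp add: is_arg_max_linorder)
  have weight: "sum (weight k m) \<Omega>' \<le> sum (weight k m) \<Omega>" if "\<Omega>' \<in> ?F" for \<Omega>'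
    using max that by (simp add: is_arg_max_linorder)
  note lexicographic = weight_lexicographic[OF F(2)[OF \<Omega>] F(2) F(3)[OF \<Omega>] F(3) weight]
  have max_energy: "is_arg_max (energy x) (\<lambda>\<Omega>. \<Omega> \<in> ?F) \<Omega>"
    using \<Omega> lexicographic(1) by (simp add: is_arg_max_linorder energy_le)
  have "decode e A i = (if i \<in> \<Omega> then x i else 0)" if "i \<in> {1..d}" for i
    using that x by (simp add: A_eq decode_def)
  note arg_min = restriction_arg_min[OF F(1) max_energy this]
  show "is_arg_min (l2_dist d x) (\<lambda>x'. \<exists>\<Omega>\<in>?F. supp d x' \<subseteq> \<Omega>) (decode e A)" by (rule arg_min(1))
  have nonzero_iff: "x i \<noteq> 0 \<longleftrightarrow> m i \<noteq> 0" if "i \<in> {1..d}" for i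
    using x[OF that] by (simp add: decode_def)
  assume z: "is_arg_min (l2_dist d x) (\<lambda>x'. supp d x' \<in> ?F) z"
  then have supp: "supp d z \<in> ?F" and "energy x \<Omega> \<le> energy x (supp d z)"
    using arg_min_exact_support_energy[OF F(1) z] \<Omega> by (simp_all add: is_arg_max_linorder)
  moreover have "\<forall>i\<in>supp d z. m i \<noteq> 0"
    using arg_min_exact_support_nonzero[OF z] nonzero_iff supp_subset by blast
  ultimately have "\<forall>i\<in>\<Omega>. m i \<noteq> 0"
    using lexicographic(2)[of "supp d z"] energy_le[OF \<Omega> supp] by simp
  then have "x i \<noteq> 0" if "i \<in> \<Omega>" for i
    using that F(1)[OF \<Omega>] nonzero_iff by blast
  then show "is_arg_min (l2_dist d x) (\<lambda>x'. supp d x' \<in> ?F) (decode e A)"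
    by (intro arg_min(2)) blast
qed

lemma arg_min_decode_if_solvable:
  assumes x: "\<And>i. i \<in> {1..d} \<Longrightarrow> x i = decode e m i"
    and A: "sep_sets_card d k \<Delta> = {} \<or> max_weight_restriction d k \<Delta> m A"
  defines "exact_min \<equiv> is_arg_min (l2_dist d x) (\<lambda>x'. supp d x' \<in> sep_sets_card d k \<Delta>)"
    and "subset_min \<equiv> is_arg_min (l2_dist d x) (\<lambda>x'. \<exists>\<Omega>\<in>sep_sets_card d k \<Delta>. supp d x' \<subseteq> \<Omega>)"
  shows "((\<exists>z. exact_min z) \<longrightarrow> exact_min (decode e A)) \<and> ((\<exists>z. subset_min z) \<longrightarrow> subset_min (decode e A))"
  using A
proof
  assume "sep_sets_card d k \<Delta> = {}"
  then show ?thesis by (simp add: exact_min_def subset_min_def is_arg_min_def)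
next
  assume "max_weight_restriction d k \<Delta> m A"
  from arg_min_decode_max_weight_restriction[OF x this]
  show ?thesis by (auto simp: exact_min_def subset_min_def)
qed

section \<open>The program\<close>

definition dp_body :: com where
  "dp_body =
     ''u'' ::= Const 0 ;;
     IF Var ''Delta'' \<prec> Var ''i'' THEN ''u'' ::= ''V''\<langle>Var ''i'' \<ominus> Var ''Delta''\<rangle> ELSE Skip ;;
     ''u'' ::= Var ''u'' \<oplus> (''c''\<langle>Var ''i''\<rangle> \<ominus> Var ''lam'') ;;
     IF ''V''\<langle>Var ''i'' \<ominus> Const 1\<rangle> \<prec> Var ''u'' THEN ''V''\<langle>Var ''i''\<rangle> \<leftarrow> Var ''u''
     ELSE ''V''\<langle>Var ''i''\<rangle> \<leftarrow> ''V''\<langle>Var ''i'' \<ominus> Const 1\<rangle>"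

definition dp_com :: com where
  "dp_com = ''V''\<langle>Const 0\<rangle> \<leftarrow> Const 0 ;; FOR ''i'' \<le> ''d'' DO dp_body"

definition select_body :: "vname \<Rightarrow> com" where
  "select_body a =
     IF ''V''\<langle>Var ''i'' \<ominus> Const 1\<rangle> \<prec> ''V''\<langle>Var ''i''\<rangle> THEN
       (''n'' ::= Var ''n'' \<oplus> Const 1 ;;
        a\<langle>Var ''n''\<rangle> \<leftarrow> Var ''i'' ;;
        ''i'' ::= Var ''i'' \<ominus> Var ''Delta'' ;;
        IF Var ''i'' \<prec> Const 0 THEN ''i'' ::= Const 0 ELSE Skip)
     ELSE ''i'' ::= Var ''i'' \<ominus> Const 1"

definition select_com :: "vname \<Rightarrow> com" where
  "select_com a =
     (''i'' ::= Var ''d'' ;; ''n'' ::= Const 0 ;; a\<langle>Const 0\<rangle> \<leftarrow> Var ''d'' \<oplus> Var ''Delta'') ;;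
     WHILE Const 0 \<prec> Var ''i'' DO select_body a ;;
     a\<langle>Var ''n'' \<oplus> Const 1\<rangle> \<leftarrow> Const 0 \<ominus> Var ''Delta''"

definition solve_com :: "vname \<Rightarrow> vname \<Rightarrow> com" where
  "solve_com v a = ''lam'' ::= Const 2 \<otimes> Var v \<oplus> Const 1 ;; dp_com ;; select_com a"

definition search_body :: com where
  "search_body =
     ''mid'' ::= (Var ''lo'' \<oplus> Var ''hi'') \<oslash> Const 2 ;;
     solve_com ''mid'' ''B'' ;;
     IF Var ''n'' \<prec> Var ''k'' THEN ''hi'' ::= Var ''mid'' ELSE ''lo'' ::= Var ''mid''"

definition search_com :: com where
  "search_com = WHILE Var ''lo'' \<oplus> Const 1 \<prec> Var ''hi'' DO search_body"

definition crossover_loop :: com where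
  "crossover_loop =
     WHILE ''B''\<langle>Var ''i'' \<oplus> Var ''sh''\<rangle> \<prec> ''A''\<langle>Var ''i'' \<oplus> Const 1\<rangle> \<oplus> Var ''Delta'' DO
       ''i'' ::= Var ''i'' \<oplus> Const 1"

definition crossover_com :: com where
  "crossover_com = (''sh'' ::= Var ''n'' \<ominus> Var ''k'' ;; ''i'' ::= Const 0) ;; crossover_loop"

definition init_body :: com where
  "init_body =
     ''v'' ::= ''x''\<langle>Var ''i''\<rangle> ;;
     ''v'' ::= Var ''v'' \<otimes> Var ''v'' ;;
     IF Const 0 \<prec> Var ''v'' THEN
       ''v'' ::= Const 2 \<otimes> ((Var ''k'' \<oplus> Const 1) \<otimes> Var ''v'' \<oplus> Const 1) ELSE Skip ;;
     ''c''\<langle>Var ''i''\<rangle> \<leftarrow> Var ''v'' ;;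
     IF Var ''mx'' \<prec> Var ''v'' THEN ''mx'' ::= Var ''v'' ELSE Skip"

definition bounds_com :: com where
  "bounds_com =
     ''lo'' ::= Const 0 \<ominus> Var ''mx'' \<otimes> Var ''k'' \<ominus> Const 1 ;;
     ''hi'' ::= Var ''mx'' \<oplus> Const 1"

definition init_com :: com where
  "init_com = ''mx'' ::= Const 0 ;; FOR ''i'' \<le> ''d'' DO init_body ;; bounds_com"

definition output_body :: com where
  "output_body =
     IF Var ''i'' \<prec> Var ''j'' THEN ''p'' ::= ''B''\<langle>Var ''j'' \<oplus> Var ''sh''\<rangle>
     ELSE ''p'' ::= ''A''\<langle>Var ''j''\<rangle> ;;
     ''xhat''\<langle>Var ''p''\<rangle> \<leftarrow> ''x''\<langle>Var ''p''\<rangle>"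

definition output_com :: com where
  "output_com = FOR ''j'' \<le> ''k'' DO output_body"

definition finish_com :: com where
  "finish_com = IF Var ''n'' \<prec> Var ''k'' THEN Skip ELSE (crossover_com ;; output_com)"

definition main_com :: com where
  "main_com =
     init_com ;;
     search_com ;;
     (solve_com ''hi'' ''A'' ;; solve_com ''lo'' ''B'') ;;
     finish_com"

lemma written_dp [simp]: "written_vars dp_com = {''i'', ''u''}" "written_arrs dp_com = {''V''}"
  by (auto simp: dp_com_def dp_body_def)

lemma written_select_body [simp]:
  "written_vars (select_body a) = {''i'', ''n''}" "written_arrs (select_body a) = {a}"
  by (auto simp: select_body_def)

lemma written_solve [simp]:
  "written_vars (solve_com v a) = {''lam'', ''i'', ''u'', ''n''}"
  "written_arrs (solve_com v a) = {''V'', a}"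
  by (auto simp: solve_com_def select_com_def)

lemma written_search_body [simp]:
  "written_vars search_body = {''mid'', ''lam'', ''i'', ''u'', ''n'', ''hi'', ''lo''}"
  "written_arrs search_body = {''V'', ''B''}"
  by (auto simp: search_body_def)

lemma written_crossover [simp]:
  "written_vars crossover_com = {''sh'', ''i''}" "written_arrs crossover_com = {}"
  by (auto simp: crossover_com_def crossover_loop_def)

lemma written_init_body [simp]:
  "written_vars init_body = {''v'', ''mx''}" "written_arrs init_body = {''c''}"
  by (auto simp: init_body_def)

section \<open>Verification of the Lagrangian search\<close>

subsection \<open>Lists in arrays\<close>

definition stored_prefix :: "nat \<Rightarrow> nat list \<Rightarrow> (nat \<Rightarrow> int) \<Rightarrow> bool" where
  "stored_prefix b xs A \<longleftrightarrow> A 0 = int b \<and> (\<forall>j<length xs. A (Suc j) = int (xs ! j))"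

text \<open>
  The sentinels \<open>d + \<Delta>\<close> and \<open>-\<Delta>\<close> around the list make the test of \<open>crossover_loop\<close> fail on its
  own at either end.
\<close>

definition stored :: "nat \<Rightarrow> nat \<Rightarrow> nat list \<Rightarrow> (nat \<Rightarrow> int) \<Rightarrow> bool" where
  "stored d \<Delta> xs A \<longleftrightarrow> stored_prefix (d + \<Delta>) xs A \<and> A (Suc (length xs)) = - int \<Delta>"

lemma stored_prefix_snoc:
  "stored_prefix b (xs @ [x]) A \<longleftrightarrow> stored_prefix b xs A \<and> A (Suc (length xs)) = int x"
  by (auto simp: stored_prefix_def nth_append less_Suc_eq)

lemma stored_prefix_upd:
  "length xs < i \<Longrightarrow> stored_prefix b xs (A(i := v)) \<longleftrightarrow> stored_prefix b xs A"
  by (auto simp: stored_prefix_def)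

lemma stored_bounds:
  assumes "stored d \<Delta> xs A" "sep_list \<Delta> d xs" "i \<le> Suc (length xs)"
  shows "- int \<Delta> \<le> A i" "A i \<le> int d + int \<Delta>"
    and "i \<le> length xs \<Longrightarrow> 0 \<le> A i" "0 < i \<Longrightarrow> A i \<le> int d"
proof -
  consider (first) "i = 0" | (entry) j where "i = Suc j" "j < length xs" | (last) "i = Suc (length xs)"
    using assms(3) by (cases i) force+
  then have "- int \<Delta> \<le> A i \<and> A i \<le> int d + int \<Delta> \<and> (i \<le> length xs \<longrightarrow> 0 \<le> A i) \<and>
    (0 < i \<longrightarrow> A i \<le> int d)"
  proof cases
    case (entry j)
    with assms(1) sep_list_nth_mem[OF assms(2), of j] show ?thesis
      by (simp add: stored_def stored_prefix_def)
  qed (use assms(1) in \<open>simp_all add: stored_def stored_prefix_def\<close>)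
  then show "- int \<Delta> \<le> A i" "A i \<le> int d + int \<Delta>"
    "i \<le> length xs \<Longrightarrow> 0 \<le> A i" "0 < i \<Longrightarrow> A i \<le> int d"
    by blast+
qed

lemma stored_less_iff_blocked:
  assumes A: "stored d \<Delta> xs A" "sep_list \<Delta> d xs" and B: "stored d \<Delta> ys B" "sep_list \<Delta> d ys"
    and i: "i \<le> length xs" "i + s \<le> length ys"
  shows "B (i + s) < A (Suc i) + int \<Delta> \<longleftrightarrow> blocked \<Delta> s xs ys i"
proof -
  consider (first) "i + s = 0" | (last) "i = length xs"
    | (entry) q where "i + s = Suc q" "i < length xs"
    using i(1) by (cases "i + s") force+
  then show ?thesis
  proof cases
    case first
    with A stored_bounds(4)[OF A, of "Suc i"] i(1) B(1) show ?thesis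
      by (simp add: blocked_def stored_def stored_prefix_def)
  next
    case last
    with A(1) stored_bounds(3)[OF B, of "i + s"] i(2) show ?thesis
      by (simp add: blocked_def stored_def)
  next
    case (entry q)
    then have "A (Suc i) = int (xs ! i)" "B (i + s) = int (ys ! q)"
      using A(1) B(1) i(2) by (simp_all add: stored_def stored_prefix_def)
    with entry show ?thesis by (auto simp: blocked_def)
  qed
qed

subsection \<open>Word bounds\<close>

text \<open>The search only tries multipliers \<open>2 v + 1\<close> with \<open>- M k - 1 \<le> v \<le> M + 1\<close>.\<close>

definition multiplier_bound :: "nat \<Rightarrow> int \<Rightarrow> int" where
  "multiplier_bound k M = 2 * (M * int k) + 2 * M + 3"

locale word_bounded_weights =
  fixes w d k \<Delta> :: nat and f :: "nat \<Rightarrow> int" and M :: int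
  assumes d: "1 \<le> d" and k: "1 \<le> k" and \<Delta>: "1 \<le> \<Delta>"
    and f: "\<And>i. i \<in> {1..d} \<Longrightarrow> 0 \<le> f i \<and> f i \<le> M"
    and room: "int d * (M + multiplier_bound k M) + M + 4 * multiplier_bound k M
      + 4 * int d + 2 * int k + 2 * int \<Delta> + 4 < 2 ^ w"
begin

abbreviation L :: int where "L \<equiv> multiplier_bound k M"

lemma M_nonneg: "0 \<le> M"
  using f[of 1] d by auto

lemma word_bounds:
  "0 \<le> M" "0 \<le> M * int k" "L = 2 * (M * int k) + 2 * M + 3" "0 \<le> int d * (M + L)"
  "int d * (M + L) + M + 4 * L + 4 * int d + 2 * int k + 2 * int \<Delta> + 4 < 2 ^ w"
  using M_nonneg room by (simp_all add: multiplier_bound_def)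

lemma fits_iff: "fits w a \<longleftrightarrow> - (2 ^ w) < a \<and> a < 2 ^ w"
  by (auto simp: fits_def abs_less_iff)

lemma fits_inputs [simp]:
  "fits w 0" "fits w 1" "fits w 2" "fits w (int d)" "fits w (int k)" "fits w (int \<Delta>)"
  using word_bounds unfolding fits_iff by linarith+

definition ready :: "state \<Rightarrow> bool" where
  "ready s \<longleftrightarrow> vars s ''d'' = int d \<and> vars s ''k'' = int k \<and> vars s ''Delta'' = int \<Delta> \<and>
     (\<forall>i\<in>{1..d}. arrs s ''c'' i = f i)"

lemma ready_unchanged:
  "ready s \<Longrightarrow> unchanged_outside c s s' \<Longrightarrow> {''d'', ''k'', ''Delta''} \<inter> written_vars c = {} \<Longrightarrow>
    ''c'' \<notin> written_arrs c \<Longrightarrow> ready s'"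
  by (simp add: ready_def unchanged_outside_def)

subsection \<open>The relaxed problem\<close>

definition dp_table :: "int \<Rightarrow> nat \<Rightarrow> state \<Rightarrow> bool" where
  "dp_table \<mu> j s \<longleftrightarrow> (\<forall>i\<le>j. arrs s ''V'' i = dp_value \<Delta> (\<lambda>i. f i - \<mu>) i)"

lemma dp_value_bounds:
  assumes "\<bar>\<mu>\<bar> \<le> L" "j \<le> d"
  shows "0 \<le> dp_value \<Delta> (\<lambda>i. f i - \<mu>) j" "dp_value \<Delta> (\<lambda>i. f i - \<mu>) j \<le> int d * (M + L)"
proof -
  have nonneg: "0 \<le> M + L" using word_bounds(1-3) by linarith
  have "dp_value \<Delta> (\<lambda>i. f i - \<mu>) j \<le> int j * (M + L)"
    using assms f nonneg by (intro dp_value_le) fastforce+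
  also have "\<dots> \<le> int d * (M + L)" using assms nonneg by (intro mult_right_mono) auto
  finally show "dp_value \<Delta> (\<lambda>i. f i - \<mu>) j \<le> int d * (M + L)" .
qed (rule dp_value_nonneg)

lemma dp_body_wp:
  assumes s: "ready s" "vars s ''lam'' = \<mu>" and \<mu>: "\<bar>\<mu>\<bar> \<le> L"
    and i: "vars s ''i'' = int (Suc i)" "i < d" and table: "dp_table \<mu> i s"
  shows "wp w dp_body (dp_table \<mu> (Suc i)) s"
proof -
  let ?value = "dp_value \<Delta> (\<lambda>i. f i - \<mu>)"
  have weight: "arrs s ''c'' (Suc i) = f (Suc i)" "0 \<le> f (Suc i)" "f (Suc i) \<le> M"
    using s i f by (auto simp: ready_def)
  have "0 \<le> ?value i" "?value i \<le> int d * (M + L)"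
    "0 \<le> ?value (Suc i - \<Delta>)" "?value (Suc i - \<Delta>) \<le> int d * (M + L)"
    using dp_value_bounds[OF \<mu>, of i] dp_value_bounds[OF \<mu>, of "Suc i - \<Delta>"] i \<Delta> by auto
  then have "fits w (1 + int i)" "fits w (int i)" "fits w (1 + int i - int \<Delta>)" "fits w \<mu>"
    "fits w (f (Suc i))" "fits w (f (Suc i) - \<mu>)" "fits w (?value i)" "fits w (?value (Suc i - \<Delta>))"
    "fits w (?value (Suc i - \<Delta>) + (f (Suc i) - \<mu>))"
    using i(2) weight(2,3) \<mu> word_bounds unfolding fits_iff by linarith+
  moreover have "arrs s ''V'' (Suc i - \<Delta>) = ?value (Suc i - \<Delta>)" "arrs s ''V'' i = ?value i"
    using table \<Delta> by (simp_all add: dp_table_def)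
  moreover have "vars s ''Delta'' = int \<Delta>" using s by (simp add: ready_def)
  moreover have "nat (1 + int i) = Suc i" "nat (1 + int i - int \<Delta>) = Suc i - \<Delta>" by simp_all
  ultimately show ?thesis
    using s(2) i(1) weight(1) table
    by (simp add: dp_body_def dp_table_def dp_value_Suc[OF \<Delta>] le_Suc_eq max_def)
qed

lemma dp_runs:
  assumes s: "ready s" "vars s ''lam'' = \<mu>" and \<mu>: "\<bar>\<mu>\<bar> \<le> L"
  shows "runs w dp_com s (50 * d) (dp_table \<mu> d)"
proof -
  have "runs w (''V''\<langle>Const 0\<rangle> \<leftarrow> Const 0) s 3 (dp_table \<mu> 0)"
    by (intro runs_wp) (simp_all add: dp_table_def)
  then have "runs w dp_com s (3 + (d * (31 + 8) + 6)) (dp_table \<mu> d)"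
    unfolding dp_com_def
  proof (rule runs_Seq)
    fix s1 assume table: "dp_table \<mu> 0 s1"
      and "unchanged_outside (''V''\<langle>Const 0\<rangle> \<leftarrow> Const 0) s s1"
    then have s1: "ready s1" "vars s1 ''lam'' = \<mu>"
      using s by (simp_all add: ready_def unchanged_outside_def)
    show "runs w (FOR ''i'' \<le> ''d'' DO dp_body) s1 (d * (31 + 8) + 6) (dp_table \<mu> d)"
    proof (rule runs_for[where I = "dp_table \<mu>"])
      fix j s' assume j: "j < d" "dp_table \<mu> j s'" "vars s' ''i'' = int (Suc j)"
        and unchanged: "unchanged_outside (FOR ''i'' \<le> ''d'' DO dp_body) s1 s'"
      have "ready s'" "vars s' ''lam'' = \<mu>"
        using s1 unchanged by (simp_all add: ready_def unchanged_outside_def dp_body_def)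
      then have "wp w dp_body (dp_table \<mu> (Suc j)) s'" using j \<mu> by (intro dp_body_wp)
      then show "runs w dp_body s' 31 (dp_table \<mu> (Suc j))"
        by (rule runs_wp) (simp add: dp_body_def)
    qed (use table s1 in \<open>simp_all add: ready_def dp_body_def dp_table_def\<close>)
  qed
  then show ?thesis by (rule runs_conseq) (use d in simp_all)
qed

definition selecting :: "vname \<Rightarrow> int \<Rightarrow> nat \<Rightarrow> state \<Rightarrow> bool" where
  "selecting a \<mu> i s \<longleftrightarrow> vars s ''i'' = int i \<and> i \<le> d \<and>
     (\<exists>ys. vars s ''n'' = int (length ys) \<and> stored_prefix (d + \<Delta>) ys (arrs s a) \<and>
       ys @ dp_list \<Delta> (\<lambda>i. f i - \<mu>) i = dp_list \<Delta> (\<lambda>i. f i - \<mu>) d)"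

lemma length_dp_list_le: "length (dp_list \<Delta> g d) \<le> d"
  using length_sep_list_le[OF max_sep_list_imp_sep_list[OF max_sep_list_dp_list]] \<Delta> by blast

lemma select_body_wp:
  assumes s: "ready s" and \<mu>: "\<bar>\<mu>\<bar> \<le> L" and a: "a \<noteq> ''V''" and table: "dp_table \<mu> d s"
    and sel: "selecting a \<mu> (Suc i) s"
  shows "wp w (select_body a) (\<lambda>s'. \<exists>i'<Suc i. selecting a \<mu> i' s') s"
proof -
  let ?value = "dp_value \<Delta> (\<lambda>i. f i - \<mu>)" and ?list = "dp_list \<Delta> (\<lambda>i. f i - \<mu>)"
  obtain ys where i: "vars s ''i'' = int (Suc i)" "Suc i \<le> d" and n: "vars s ''n'' = int (length ys)"
    and ys: "stored_prefix (d + \<Delta>) ys (arrs s a)" "ys @ ?list (Suc i) = ?list d"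
    using sel by (auto simp: selecting_def)
  have len: "length ys \<le> d" using length_dp_list_le ys(2) by (metis le_trans length_append le_add1)
  have value_bounds: "0 \<le> ?value i" "?value i \<le> int d * (M + L)"
    "0 \<le> ?value (Suc i)" "?value (Suc i) \<le> int d * (M + L)"
    using dp_value_bounds[OF \<mu>] i by auto
  have fits: "fits w (int i)" "fits w (1 + int i)" "fits w (1 + int i - int \<Delta>)"
    "fits w (int (length ys))" "fits w (int (length ys) + 1)"
    "fits w (?value i)" "fits w (?value (Suc i))"
    using i(2) len value_bounds word_bounds unfolding fits_iff by linarith+
  have state: "arrs s ''V'' i = ?value i" "arrs s ''V'' (Suc i) = ?value (Suc i)"
    "vars s ''Delta'' = int \<Delta>"
    using table i s by (auto simp: dp_table_def ready_def)
  have nat: "nat (1 + int i) = Suc i" "nat (int (length ys) + 1) = Suc (length ys)" by auto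
  define Q where "Q = (\<lambda>s'. \<exists>i'<Suc i. selecting a \<mu> i' s')"
  have "wp w (select_body a) Q s"
  proof (cases "?value i < ?value (Suc i)")
    case False
    have "Q s'" if "vars s' ''i'' = int i" "vars s' ''n'' = int (length ys)" "arrs s' = arrs s" for s'
      using that False ys i unfolding Q_def selecting_def by (auto simp: dp_list_Suc[OF \<Delta>])
    with False show ?thesis
      using fits state i(1) n value_bounds a by (simp add: select_body_def nat)
  next
    case True
    have "Q s'" if "vars s' ''i'' = int (Suc i - \<Delta>)" "vars s' ''n'' = int (length ys) + 1"
      "arrs s' a = (arrs s a)(Suc (length ys) := 1 + int i)" for s'
      using that True ys i \<Delta> unfolding Q_def selecting_def
      by (intro exI[of _ "Suc i - \<Delta>"] conjI exI[of _ "ys @ [Suc i]"])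
        (auto simp: dp_list_Suc[OF \<Delta>] stored_prefix_snoc stored_prefix_upd)
    with True show ?thesis
      using fits state i(1) n value_bounds a by (simp add: select_body_def nat)
  qed
  then show ?thesis by (simp add: Q_def)
qed

lemma select_loop_runs:
  assumes s: "ready s" and \<mu>: "\<bar>\<mu>\<bar> \<le> L" and a: "a \<noteq> ''V''" "a \<noteq> ''c''"
    and table: "dp_table \<mu> d s" and sel: "selecting a \<mu> d s"
  shows "runs w (WHILE Const 0 \<prec> Var ''i'' DO select_body a) s (29 * d + 4) (selecting a \<mu> 0)"
proof -
  let ?b = "Const 0 \<prec> Var ''i''"
  have "runs w (WHILE ?b DO select_body a) s (d * (1 + bcost ?b + 25) + (1 + bcost ?b))
    (selecting a \<mu> 0)"
    using sel
  proof (rule runs_While[where I = "selecting a \<mu>"])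
    fix i s' assume sel: "selecting a \<mu> i s'" and unchanged: "unchanged_outside (select_body a) s s'"
    then have i: "vars s' ''i'' = int i" "i \<le> d" by (simp_all add: selecting_def)
    have "fits w (int i)" using i word_bounds unfolding fits_iff by linarith
    then show "safe_bexp w s' ?b" using i by simp
    show "selecting a \<mu> 0 s'" if "\<not> ideal_bval s' ?b" using that sel i by simp
    assume "ideal_bval s' ?b"
    then obtain j where j: "i = Suc j" using i by (cases i) auto
    have "ready s'" using s unchanged by (rule ready_unchanged) (use a in simp_all)
    moreover have "dp_table \<mu> d s'"
      using table unchanged a by (simp add: dp_table_def unchanged_outside_def)
    ultimately have "wp w (select_body a) (\<lambda>s''. \<exists>i'<i. selecting a \<mu> i' s'') s'"
      unfolding j using \<mu> a sel[unfolded j] by (intro select_body_wp)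
    then show "runs w (select_body a) s' 25 (\<lambda>s''. \<exists>i'<i. selecting a \<mu> i' s'')"
      by (rule runs_wp) (simp add: select_body_def)
  qed
  then show ?thesis by (rule runs_conseq) simp_all
qed

lemma select_finish_wp:
  assumes s: "ready s" "selecting a \<mu> 0 s"
  defines "xs \<equiv> dp_list \<Delta> (\<lambda>i. f i - \<mu>) d"
  shows "wp w (a\<langle>Var ''n'' \<oplus> Const 1\<rangle> \<leftarrow> Const 0 \<ominus> Var ''Delta'')
    (\<lambda>s'. stored d \<Delta> xs (arrs s' a) \<and> vars s' ''n'' = int (length xs)) s"
proof -
  have "fits w (int (length xs))" "fits w (int (length xs) + 1)" "fits w (- int \<Delta>)"
    using length_dp_list_le[of "\<lambda>i. f i - \<mu>"] word_bounds unfolding fits_iff xs_def by linarith+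
  moreover have "nat (int (length xs) + 1) = Suc (length xs)" by simp
  ultimately show ?thesis
    using s by (auto simp: ready_def selecting_def stored_def stored_prefix_upd xs_def)
qed

lemma select_runs:
  assumes s: "ready s" and \<mu>: "\<bar>\<mu>\<bar> \<le> L" and a: "a \<noteq> ''V''" "a \<noteq> ''c''" and table: "dp_table \<mu> d s"
  defines "xs \<equiv> dp_list \<Delta> (\<lambda>i. f i - \<mu>) d"
  shows "runs w (select_com a) s (50 * d)
    (\<lambda>s'. stored d \<Delta> xs (arrs s' a) \<and> vars s' ''n'' = int (length xs))"
proof -
  let ?init = "''i'' ::= Var ''d'' ;; ''n'' ::= Const 0 ;; a\<langle>Const 0\<rangle> \<leftarrow> Var ''d'' \<oplus> Var ''Delta''"
  have "fits w (int d + int \<Delta>)" using word_bounds unfolding fits_iff by linarith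
  then have "wp w ?init (\<lambda>s'. ready s' \<and> dp_table \<mu> d s' \<and> selecting a \<mu> d s') s"
    using s table a by (simp add: ready_def dp_table_def selecting_def stored_prefix_def)
  then have "hoare w (\<lambda>s'. s' = s) ?init 9
    (\<lambda>s'. ready s' \<and> dp_table \<mu> d s' \<and> selecting a \<mu> d s')"
    by (intro hoareI runs_wp) simp_all
  also have "hoare w (\<lambda>s'. ready s' \<and> dp_table \<mu> d s' \<and> selecting a \<mu> d s')
    (WHILE Const 0 \<prec> Var ''i'' DO select_body a) (29 * d + 4) (\<lambda>s'. ready s' \<and> selecting a \<mu> 0 s')"
  proof (rule hoareI)
    fix s' assume s': "ready s' \<and> dp_table \<mu> d s' \<and> selecting a \<mu> d s'"
    show "runs w (WHILE Const 0 \<prec> Var ''i'' DO select_body a) s' (29 * d + 4)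
        (\<lambda>s'. ready s' \<and> selecting a \<mu> 0 s')"
      by (rule runs_conseq[OF select_loop_runs[OF _ \<mu> a]])
        (use s' a in \<open>auto elim: ready_unchanged\<close>)
  qed
  also have "hoare w (\<lambda>s'. ready s' \<and> selecting a \<mu> 0 s')
    (a\<langle>Var ''n'' \<oplus> Const 1\<rangle> \<leftarrow> Const 0 \<ominus> Var ''Delta'') 7
    (\<lambda>s'. stored d \<Delta> xs (arrs s' a) \<and> vars s' ''n'' = int (length xs))"
    unfolding xs_def by (intro hoareI runs_wp select_finish_wp) simp_all
  finally have "runs w (select_com a) s (9 + (29 * d + 4) + 7)
    (\<lambda>s'. stored d \<Delta> xs (arrs s' a) \<and> vars s' ''n'' = int (length xs))"
    unfolding select_com_def by (rule hoareD) simp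
  then show ?thesis by (rule runs_conseq) (use d in simp_all)
qed

definition in_search_range :: "int \<Rightarrow> bool" where
  "in_search_range v \<longleftrightarrow> - (M * int k) - 1 \<le> v \<and> v \<le> M + 1"

lemma in_search_range_bounds:
  assumes "in_search_range v"
  shows "fits w v" "fits w (2 * v)" "fits w (2 * v + 1)" "\<bar>2 * v + 1\<bar> \<le> L"
  using assms word_bounds unfolding in_search_range_def fits_iff by linarith+

abbreviation relaxed_at :: "int \<Rightarrow> nat list" where
  "relaxed_at \<equiv> relaxed \<Delta> d f"

lemma solve_runs:
  assumes s: "ready s" and v: "vars s u = v" "in_search_range v" and a: "a \<noteq> ''V''" "a \<noteq> ''c''"
  shows "runs w (solve_com u a) s (110 * d)
    (\<lambda>s'. ready s' \<and> stored d \<Delta> (relaxed_at v) (arrs s' a) \<and>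
      vars s' ''n'' = int (length (relaxed_at v)))"
proof -
  let ?Q = "\<lambda>s'. stored d \<Delta> (relaxed_at v) (arrs s' a) \<and> vars s' ''n'' = int (length (relaxed_at v))"
  define \<mu> where "\<mu> = 2 * v + 1"
  have \<mu>: "\<bar>\<mu>\<bar> \<le> L" unfolding \<mu>_def by (rule in_search_range_bounds[OF v(2)])
  have "hoare w (\<lambda>s'. s' = s) (''lam'' ::= Const 2 \<otimes> Var u \<oplus> Const 1) 6
      (\<lambda>s'. ready s' \<and> vars s' ''lam'' = \<mu>)"
    using s v in_search_range_bounds[OF v(2)] by (intro hoareI runs_wp) (simp_all add: ready_def \<mu>_def)
  also have "hoare w (\<lambda>s'. ready s' \<and> vars s' ''lam'' = \<mu>) dp_com (50 * d)
      (\<lambda>s'. ready s' \<and> dp_table \<mu> d s')"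
  proof (rule hoareI)
    fix s' assume "ready s' \<and> vars s' ''lam'' = \<mu>"
    then show "runs w dp_com s' (50 * d) (\<lambda>s'. ready s' \<and> dp_table \<mu> d s')"
      using \<mu> by (intro runs_conseq[OF dp_runs]) (auto elim: ready_unchanged)
  qed
  also have "hoare w (\<lambda>s'. ready s' \<and> dp_table \<mu> d s') (select_com a) (50 * d) ?Q"
    unfolding relaxed_def \<mu>_def[symmetric] using \<mu> a by (intro hoareI select_runs) auto
  finally have "runs w (solve_com u a) s (6 + 50 * d + 50 * d) ?Q"
    unfolding solve_com_def by (rule hoareD) simp
  then show ?thesis by (rule runs_conseq) (use d s a in \<open>simp_all add: ready_unchanged[of s]\<close>)
qed

subsection \<open>Bisection\<close>

definition bracket :: "int \<Rightarrow> int \<Rightarrow> bool" where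
  "bracket l h \<longleftrightarrow> in_search_range l \<and> in_search_range h \<and> l < h \<and>
     (sep_sets_card d k \<Delta> \<noteq> {} \<longrightarrow> k \<le> length (relaxed_at l)) \<and> length (relaxed_at h) < k"

lemma bracket_initial:
  assumes f_le: "\<And>i. i \<in> {1..d} \<Longrightarrow> f i \<le> B" and B: "0 \<le> B" "B \<le> M"
  shows "bracket (- (B * int k) - 1) (B + 1)"
proof -
  have Bk: "0 \<le> B * int k" "B * int k \<le> M * int k" using B by (auto intro: mult_right_mono)
  have "k \<le> length (relaxed_at (- (B * int k) - 1))" if "sep_sets_card d k \<Delta> \<noteq> {}"
  proof -
    obtain \<Omega> where "\<Omega> \<in> sep_sets_card d k \<Delta>" using \<open>sep_sets_card d k \<Delta> \<noteq> {}\<close> by blast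
    then obtain zs where zs: "sep_list \<Delta> d zs" "length zs = k" "set zs = \<Omega>"
      by (rule sep_sets_card_obtain_sep_list)
    have "2 * (- (B * int k) - 1) + 1 < - (B * int k)" using Bk by simp
    then show ?thesis
      using f f_le B(1)
      by (intro length_max_sep_list_ge[OF _ _ max_sep_list_relaxed[OF \<Delta>] zs(1,2)]) auto
  qed
  moreover have "relaxed_at (B + 1) = []"
    using f_le B by (intro max_sep_list_negative_weights[OF _ max_sep_list_relaxed[OF \<Delta>]]) fastforce
  moreover have "in_search_range (- (B * int k) - 1)" "in_search_range (B + 1)"
    "- (B * int k) - 1 < B + 1"
    using B Bk word_bounds(2) unfolding in_search_range_def by linarith+
  ultimately show ?thesis using k by (simp add: bracket_def)
qed

lemma bracket_mid:
  assumes "bracket l h" "l + 1 < h"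
  defines "mid \<equiv> (l + h) div 2"
  shows "if length (relaxed_at mid) < k then bracket l mid else bracket mid h"
proof -
  have "l < mid" "mid < h" using assms(2) unfolding mid_def by linarith+
  with assms(1) show ?thesis by (auto simp: bracket_def in_search_range_def)
qed

definition bracketed :: "int \<Rightarrow> int \<Rightarrow> state \<Rightarrow> bool" where
  "bracketed l h s \<longleftrightarrow> vars s ''lo'' = l \<and> vars s ''hi'' = h \<and> bracket l h"

lemma search_body_runs:
  assumes s: "ready s" and lh: "bracketed l h s" "l + 1 < h"
  shows "runs w search_body s (110 * d + 12)
    (\<lambda>s'. \<exists>l' h'. bracketed l' h' s' \<and> 2 * (h' - l') \<le> h - l + 1)" (is "runs _ _ _ _ ?Q")
proof -
  define mid where "mid = (l + h) div 2"
  let ?n = "length (relaxed_at mid)"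
  let ?P = "\<lambda>s'. ready s' \<and> bracketed l h s' \<and> vars s' ''mid'' = mid"
  have br: "vars s ''lo'' = l" "vars s ''hi'' = h" "in_search_range l" "in_search_range h"
    using lh(1) by (simp_all add: bracketed_def bracket_def)
  have mid: "l < mid" "mid < h" using lh(2) unfolding mid_def by linarith+
  have range: "in_search_range mid" using br mid by (simp add: in_search_range_def)
  have "fits w (l + h)" using br word_bounds unfolding in_search_range_def fits_iff by linarith
  then have "hoare w (\<lambda>s'. s' = s) (''mid'' ::= (Var ''lo'' \<oplus> Var ''hi'') \<oslash> Const 2) 6 ?P"
    using s lh(1) br range in_search_range_bounds(1)
    by (intro hoareI runs_wp) (simp_all add: mid_def ready_def bracketed_def)
  also have "hoare w ?P (solve_com ''mid'' ''B'') (110 * d) (\<lambda>s'. ?P s' \<and> vars s' ''n'' = int ?n)"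
  proof (rule hoareI)
    fix s' assume s': "?P s'"
    then have "runs w (solve_com ''mid'' ''B'') s' (110 * d) (\<lambda>s''. ready s'' \<and>
        stored d \<Delta> (relaxed_at mid) (arrs s'' ''B'') \<and> vars s'' ''n'' = int ?n)"
      using range by (intro solve_runs) simp_all
    then show "runs w (solve_com ''mid'' ''B'') s' (110 * d) (\<lambda>s'. ?P s' \<and> vars s' ''n'' = int ?n)"
      by (rule runs_conseq) (use s' in \<open>simp_all add: bracketed_def unchanged_outside_def\<close>)
  qed
  also have "hoare w (\<lambda>s'. ?P s' \<and> vars s' ''n'' = int ?n)
    (IF Var ''n'' \<prec> Var ''k'' THEN ''hi'' ::= Var ''mid'' ELSE ''lo'' ::= Var ''mid'') 6 ?Q"
  proof (rule hoareI, rule runs_wp)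
    fix s' assume s': "?P s' \<and> vars s' ''n'' = int ?n"
    have fits: "fits w (int ?n)" "fits w mid"
      using length_relaxed_le[OF \<Delta>, of d f mid] word_bounds in_search_range_bounds(1)[OF range]
      unfolding fits_iff by linarith+
    have "2 * mid \<le> l + h" "l + h \<le> 2 * mid + 1" unfolding mid_def by presburger+
    then have half: "2 * (mid - l) \<le> h - l + 1" "2 * (h - mid) \<le> h - l + 1"
      by (simp_all add: algebra_simps)
    have "if ?n < k then bracket l mid else bracket mid h"
      unfolding mid_def by (rule bracket_mid) (use lh in \<open>simp_all add: bracketed_def\<close>)
    then show "wp w (IF Var ''n'' \<prec> Var ''k'' THEN ''hi'' ::= Var ''mid'' ELSE ''lo'' ::= Var ''mid'')
        ?Q s'"
      using s' fits half by (simp add: bracketed_def ready_def)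
  qed simp
  finally have "runs w search_body s (6 + 110 * d + 6) ?Q"
    unfolding search_body_def by (rule hoareD) simp
  then show ?thesis by (rule runs_conseq) simp_all
qed

lemma search_runs:
  assumes s: "ready s" and lh: "bracketed l h s" "h - l \<le> 2 ^ N"
  shows "runs w search_com s (N * (130 * d) + 6) (\<lambda>s'. \<exists>l. bracketed l (l + 1) s')"
    (is "runs _ _ _ _ ?Q")
proof -
  let ?b = "Var ''lo'' \<oplus> Const 1 \<prec> Var ''hi''"
  let ?I = "\<lambda>n s. \<exists>l h. bracketed l h s \<and> h - l \<le> 2 ^ n"
  have "?I N s" using lh by blast
  then have "runs w search_com s (N * (1 + bcost ?b + (110 * d + 12)) + (1 + bcost ?b)) ?Q"
    unfolding search_com_def
  proof (rule runs_While[where I = ?I])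
    fix n s' assume "?I n s'" and unchanged: "unchanged_outside search_body s s'"
    then obtain l h where lh: "bracketed l h s'" "h - l \<le> 2 ^ n" by blast
    then have br: "vars s' ''lo'' = l" "vars s' ''hi'' = h"
      "in_search_range l" "in_search_range h" "l < h"
      by (simp_all add: bracketed_def bracket_def)
    have "fits w (l + 1)" using br(3) word_bounds unfolding in_search_range_def fits_iff by linarith
    then show "safe_bexp w s' ?b" using br in_search_range_bounds(1) by simp
    show "?Q s'" if "\<not> ideal_bval s' ?b"
    proof -
      have "h = l + 1" using that br by simp
      with lh show ?thesis by blast
    qed
    assume "ideal_bval s' ?b"
    then have less: "l + 1 < h" using br by simp
    then obtain n' where n: "n = Suc n'" using lh(2) by (cases n) auto
    have "ready s'" using s unchanged by (rule ready_unchanged) simp_all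
    from search_body_runs[OF this lh(1) less]
    show "runs w search_body s' (110 * d + 12) (\<lambda>s''. \<exists>n'<n. ?I n' s'')"
    proof (rule runs_conseq)
      fix s'' assume "\<exists>l' h'. bracketed l' h' s'' \<and> 2 * (h' - l') \<le> h - l + 1"
      then obtain l' h' where "bracketed l' h' s''" "2 * (h' - l') \<le> 2 * 2 ^ n' + 1"
        using lh(2) n by fastforce
      then show "\<exists>n'<n. ?I n' s''"
        unfolding n by (intro exI[of _ n'] conjI exI[of _ l'] exI[of _ h']) auto
    qed simp
  qed
  then show ?thesis
    by (rule runs_conseq) (use d in \<open>simp_all add: mult_le_mono2\<close>)
qed

subsection \<open>Crossover\<close>

lemma crossover_loop_runs:
  assumes s: "ready s" "vars s ''sh'' = int sh" "vars s ''i'' = 0"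
    and xs: "sep_list \<Delta> d xs" and ys: "sep_list \<Delta> d ys" and len: "length xs + sh \<le> length ys"
    and A: "stored d \<Delta> xs (arrs s ''A'')" and B: "stored d \<Delta> ys (arrs s ''B'')"
  shows "runs w crossover_loop s (16 * d + 12) (\<lambda>s'. vars s' ''i'' = int (crossover_point \<Delta> sh xs ys))"
    (is "runs _ _ _ _ ?Q")
proof -
  let ?b = "''B''\<langle>Var ''i'' \<oplus> Var ''sh''\<rangle> \<prec> ''A''\<langle>Var ''i'' \<oplus> Const 1\<rangle> \<oplus> Var ''Delta''"
  let ?inc = "''i'' ::= Var ''i'' \<oplus> Const 1"
  let ?point = "crossover_point \<Delta> sh xs ys"
  let ?I = "\<lambda>r s'. r \<le> ?point \<and> vars s' ''i'' = int (?point - r)"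
  have lens: "length xs \<le> d" "length ys \<le> d" "?point \<le> length xs"
    using length_sep_list_le[OF xs \<Delta>] length_sep_list_le[OF ys \<Delta>] crossover_point_le_length by auto
  have "?I ?point s" using s(3) by simp
  then have "runs w crossover_loop s (?point * (1 + bcost ?b + 4) + (1 + bcost ?b)) ?Q"
    unfolding crossover_loop_def
  proof (rule runs_While[where I = ?I])
    fix r s' assume inv: "?I r s'" and unchanged: "unchanged_outside ?inc s s'"
    define i where "i = ?point - r"
    have i: "i \<le> ?point" "vars s' ''i'' = int i" using inv by (simp_all add: i_def)
    have state: "vars s' ''Delta'' = int \<Delta>" "vars s' ''sh'' = int sh" "arrs s' = arrs s"
      using s unchanged by (auto simp: unchanged_outside_def ready_def)
    have ilen: "i \<le> length xs" "i + sh \<le> length ys" using i lens len by auto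
    let ?a = "arrs s ''A'' (Suc i)" and ?c = "arrs s ''B'' (i + sh)"
    have ac: "- int \<Delta> \<le> ?a" "?a \<le> int d + int \<Delta>" "- int \<Delta> \<le> ?c" "?c \<le> int d + int \<Delta>"
      using stored_bounds(1,2)[OF A xs, of "Suc i"] stored_bounds(1,2)[OF B ys, of "i + sh"] ilen
      by simp_all
    have fits: "fits w (int i)" "fits w (int i + 1)" "fits w (int sh)" "fits w (int i + int sh)"
      "fits w ?a" "fits w ?c" "fits w (?a + int \<Delta>)"
      using ac lens ilen word_bounds unfolding fits_iff by linarith+
    have nat: "nat (int i + 1) = Suc i" "nat (int i + int sh) = i + sh" by simp_all
    then show "safe_bexp w s' ?b" using i state fits by simp
    have test: "ideal_bval s' ?b \<longleftrightarrow> blocked \<Delta> sh xs ys i"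
      using stored_less_iff_blocked[OF A xs B ys ilen] i state nat by simp
    show "?Q s'" if "\<not> ideal_bval s' ?b"
      using that test i blocked_less_crossover_point[of i] by (cases "i = ?point") auto
    assume "ideal_bval s' ?b"
    then have "i \<noteq> ?point" using test not_blocked_crossover_point by metis
    then have "0 < r" "int i + 1 = int (?point - (r - 1))" using inv by (auto simp: i_def)
    then show "runs w ?inc s' 4 (\<lambda>s''. \<exists>r'<r. ?I r' s'')"
      using i fits inv by (intro runs_wp) (auto intro!: exI[of _ "r - 1"])
  qed
  then show ?thesis by (rule runs_conseq) (use lens in simp_all)
qed

lemma crossover_runs:
  assumes s: "ready s" and xs: "sep_list \<Delta> d xs" and ys: "sep_list \<Delta> d ys"
    and len: "length xs \<le> k" "k \<le> length ys" and n: "vars s ''n'' = int (length ys)"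
    and A: "stored d \<Delta> xs (arrs s ''A'')" and B: "stored d \<Delta> ys (arrs s ''B'')"
  defines "sh \<equiv> length ys - k"
  shows "runs w crossover_com s (34 * d)
    (\<lambda>s'. vars s' ''sh'' = int sh \<and> vars s' ''i'' = int (crossover_point \<Delta> sh xs ys))"
    (is "runs _ _ _ _ ?Q")
proof -
  let ?init = "''sh'' ::= Var ''n'' \<ominus> Var ''k'' ;; ''i'' ::= Const 0"
  have "fits w (int (length ys))" "fits w (int (length ys) - int k)"
    using length_sep_list_le[OF ys \<Delta>] word_bounds unfolding fits_iff by linarith+
  then have "runs w ?init s 6 (\<lambda>s'. vars s' ''sh'' = int sh \<and> vars s' ''i'' = 0)"
    using s n len by (intro runs_wp) (simp_all add: ready_def sh_def)
  then have "runs w crossover_com s (6 + (16 * d + 12)) ?Q"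
    unfolding crossover_com_def
  proof (rule runs_Seq)
    fix s1 assume s1: "vars s1 ''sh'' = int sh \<and> vars s1 ''i'' = 0"
      and unchanged: "unchanged_outside ?init s s1"
    have "ready s1" using s unchanged by (rule ready_unchanged) simp_all
    moreover have "arrs s1 = arrs s" using unchanged by (auto simp: unchanged_outside_def)
    moreover have "length xs + sh \<le> length ys" using len by (simp add: sh_def)
    ultimately show "runs w crossover_loop s1 (16 * d + 12) ?Q"
      using s1 A B by (intro runs_conseq[OF crossover_loop_runs[OF _ _ _ xs ys]])
        (auto simp: unchanged_outside_def crossover_loop_def)
  qed
  then show ?thesis by (rule runs_conseq) (use d in simp_all)
qed

end

section \<open>Verification of the projection program\<close>

locale projection_instance = word_bounded_weights w d k \<Delta> "weight k m" M
  for w d k \<Delta> :: nat and m :: "nat \<Rightarrow> int" and M :: int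
begin

definition loaded :: "state \<Rightarrow> bool" where
  "loaded s \<longleftrightarrow> (\<forall>i\<in>{1..d}. arrs s ''x'' i = m i) \<and> arrs s ''xhat'' = (\<lambda>_. 0)"

lemma loaded_unchanged:
  "loaded s \<Longrightarrow> unchanged_outside c s s' \<Longrightarrow> {''x'', ''xhat''} \<inter> written_arrs c = {} \<Longrightarrow> loaded s'"
  by (simp add: loaded_def unchanged_outside_def)

lemma coefficient_bounds:
  assumes "i \<in> {1..d}"
  shows "\<bar>m i\<bar> \<le> M" "(m i)\<^sup>2 \<le> M" "0 \<le> (int k + 1) * (m i)\<^sup>2" "(int k + 1) * (m i)\<^sup>2 \<le> M"
proof -
  have "2 * ((int k + 1) * (m i)\<^sup>2) \<le> M" using f[OF assms] by (cases "m i = 0") (auto simp: weight_def)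
  moreover show nonneg: "0 \<le> (int k + 1) * (m i)\<^sup>2" by simp
  ultimately show le: "(int k + 1) * (m i)\<^sup>2 \<le> M" by linarith
  have "1 * (m i)\<^sup>2 \<le> (int k + 1) * (m i)\<^sup>2" by (rule mult_right_mono) simp_all
  with le show "(m i)\<^sup>2 \<le> M" by simp
  moreover have "\<bar>m i\<bar> \<le> (m i)\<^sup>2"
    using mult_left_mono[of 1 "\<bar>m i\<bar>" "\<bar>m i\<bar>"] by (cases "m i = 0") (auto simp: power2_eq_square)
  ultimately show "\<bar>m i\<bar> \<le> M" by simp
qed

subsection \<open>Weights and initial bracket\<close>

definition weighted :: "nat \<Rightarrow> state \<Rightarrow> bool" where
  "weighted j s \<longleftrightarrow> 0 \<le> vars s ''mx'' \<and> vars s ''mx'' \<le> M \<and>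
     (\<forall>i\<in>{1..j}. arrs s ''c'' i = weight k m i \<and> weight k m i \<le> vars s ''mx'')"

lemma init_body_wp:
  assumes s: "loaded s" "vars s ''k'' = int k" and i: "vars s ''i'' = int (Suc i)" "i < d"
    and weighted: "weighted i s"
  shows "wp w init_body (weighted (Suc i)) s"
proof -
  define q where "q = m (Suc i)"
  define v where "v = weight k m (Suc i)"
  have mem: "Suc i \<in> {1..d}" using i(2) by simp
  have x: "arrs s ''x'' (Suc i) = q" using s(1) mem by (simp add: loaded_def q_def)
  have v: "v = (if q = 0 then 0 else 2 * ((int k + 1) * (q * q) + 1))" "0 \<le> v" "v \<le> M"
    using f[OF mem] by (simp_all add: v_def q_def weight_def power2_eq_square)
  have mx: "0 \<le> vars s ''mx''" "vars s ''mx'' \<le> M" using weighted by (simp_all add: weighted_def)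
  have "- M \<le> q" "q \<le> M" "q * q \<le> M" "0 \<le> q * q"
    "0 \<le> (int k + 1) * (q * q)" "(int k + 1) * (q * q) \<le> M"
    using coefficient_bounds[OF mem] by (simp_all add: q_def abs_le_iff power2_eq_square)
  then have fits: "fits w (1 + int i)" "fits w (int k + 1)" "fits w q" "fits w (q * q)"
    "fits w ((int k + 1) * (q * q))" "fits w ((int k + 1) * (q * q) + 1)" "fits w v"
    "fits w (vars s ''mx'')"
    using i(2) v(2,3) mx word_bounds unfolding fits_iff by linarith+
  define Q where "Q = weighted (Suc i)"
  have Q: "Q s'" if "arrs s' ''c'' = (arrs s ''c'')(Suc i := v)"
    "vars s' ''mx'' = max (vars s ''mx'') v" for s'
    using that weighted v mx unfolding Q_def
    by (auto simp: weighted_def atLeastAtMostSuc_conv v_def)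
  have nat: "nat (1 + int i) = Suc i" by simp
  have "wp w init_body Q s"
  proof (cases "q = 0")
    case True
    then show ?thesis using fits s i(1) x Q v mx by (simp add: init_body_def nat)
  next
    case False
    then have "0 < q * q" by (simp add: zero_less_mult_iff) linarith
    moreover have "v = 2 * ((int k + 1) * (q * q) + 1)" using v(1) False by simp
    ultimately show ?thesis
      using fits s i(1) x Q by (simp add: init_body_def nat max_def)
  qed
  then show ?thesis by (simp add: Q_def)
qed

lemma weights_runs:
  assumes s: "loaded s" "vars s ''d'' = int d" "vars s ''k'' = int k" "vars s ''mx'' = 0"
  shows "runs w (FOR ''i'' \<le> ''d'' DO init_body) s (38 * d + 6) (weighted d)"
proof -
  have "runs w (FOR ''i'' \<le> ''d'' DO init_body) s (d * (30 + 8) + 6) (weighted d)"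
  proof (rule runs_for[where I = weighted])
    fix j s' assume j: "j < d" "weighted j s'" "vars s' ''i'' = int (Suc j)"
      and unchanged: "unchanged_outside (FOR ''i'' \<le> ''d'' DO init_body) s s'"
    have "loaded s'" using s(1) unchanged by (rule loaded_unchanged) simp
    moreover have "vars s' ''k'' = int k" using s(3) unchanged by (simp add: unchanged_outside_def)
    ultimately have "wp w init_body (weighted (Suc j)) s'" using j by (intro init_body_wp)
    then show "runs w init_body s' 30 (weighted (Suc j))"
      by (rule runs_wp) (simp add: init_body_def)
  qed (use s M_nonneg in \<open>simp_all add: weighted_def\<close>)
  then show ?thesis by (rule runs_conseq) simp_all
qed

lemma init_runs:
  assumes s: "loaded s" "vars s ''d'' = int d" "vars s ''k'' = int k" "vars s ''Delta'' = int \<Delta>"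
    and N: "M * int k + M + 2 \<le> 2 ^ N"
  shows "runs w init_com s (60 * d)
    (\<lambda>s'. ready s' \<and> loaded s' \<and> (\<exists>l h. bracketed l h s' \<and> h - l \<le> 2 ^ N))" (is "runs _ _ _ _ ?Q")
proof -
  let ?input = "\<lambda>s'. loaded s' \<and> vars s' ''d'' = int d \<and> vars s' ''k'' = int k \<and>
    vars s' ''Delta'' = int \<Delta>"
  have "hoare w (\<lambda>s'. s' = s) (''mx'' ::= Const 0) 2 (\<lambda>s'. ?input s' \<and> vars s' ''mx'' = 0)"
    using s by (intro hoareI runs_wp) (simp_all add: loaded_def)
  also have "hoare w (\<lambda>s'. ?input s' \<and> vars s' ''mx'' = 0) (FOR ''i'' \<le> ''d'' DO init_body) (38 * d + 6)
    (\<lambda>s'. ?input s' \<and> weighted d s')"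
  proof (rule hoareI)
    fix s' assume s': "?input s' \<and> vars s' ''mx'' = 0"
    then have "runs w (FOR ''i'' \<le> ''d'' DO init_body) s' (38 * d + 6) (weighted d)"
      by (intro weights_runs) simp_all
    then show "runs w (FOR ''i'' \<le> ''d'' DO init_body) s' (38 * d + 6) (\<lambda>s'. ?input s' \<and> weighted d s')"
      by (rule runs_conseq) (use s' in \<open>simp_all add: loaded_def unchanged_outside_def\<close>)
  qed
  also have "hoare w (\<lambda>s'. ?input s' \<and> weighted d s') bounds_com 12 ?Q"
  proof (rule hoareI, rule runs_wp)
    fix s' assume s': "?input s' \<and> weighted d s'"
    define B where "B = vars s' ''mx''"
    have B: "0 \<le> B" "B \<le> M" and weights: "\<And>i. i \<in> {1..d} \<Longrightarrow> weight k m i \<le> B"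
      using s' by (simp_all add: weighted_def B_def)
    have bracket: "bracket (- (B * int k) - 1) (B + 1)" by (rule bracket_initial[OF weights B])
    have Bk: "0 \<le> B * int k" "B * int k \<le> M * int k" using B by (auto intro: mult_right_mono)
    have "fits w B" "fits w (B * int k)" "fits w (- (B * int k))" "fits w (- (B * int k) - 1)"
      "fits w (B + 1)" "B + 1 - (- (B * int k) - 1) \<le> 2 ^ N"
      using B Bk N word_bounds unfolding fits_iff by linarith+
    with s' bracket show "wp w bounds_com ?Q s'"
      by (simp add: bounds_com_def B_def ready_def loaded_def weighted_def bracketed_def)
  qed (simp add: bounds_com_def)
  finally have "runs w init_com s (2 + (38 * d + 6) + 12) ?Q"
    unfolding init_com_def by (rule hoareD) simp
  then show ?thesis by (rule runs_conseq) (use d in simp_all)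
qed

subsection \<open>Output\<close>

lemma output_body_wp:
  assumes s: "vars s ''sh'' = int sh" "vars s ''i'' = int (crossover_point \<Delta> sh xs ys)"
      "\<forall>i\<in>{1..d}. arrs s ''x'' i = m i"
    and xs: "sep_list \<Delta> d xs" "stored d \<Delta> xs (arrs s ''A'')"
    and ys: "sep_list \<Delta> d ys" "stored d \<Delta> ys (arrs s ''B'')"
    and len: "length xs + sh \<le> length ys" "k = length ys - sh"
    and j: "vars s ''j'' = int (Suc j)" "j < k"
  defines "us \<equiv> crossover \<Delta> sh xs ys"
  assumes xhat: "arrs s ''xhat'' = (\<lambda>p. if p \<in> set (take j us) then m p else 0)"
  shows "wp w output_body
    (\<lambda>s'. arrs s' ''xhat'' = (\<lambda>p. if p \<in> set (take (Suc j) us) then m p else 0)) s"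
proof -
  let ?i = "crossover_point \<Delta> sh xs ys"
  have us: "length us = k" "sep_list \<Delta> d us"
    using length_crossover[OF len(1)] sep_list_crossover[OF xs(1) ys(1)] len(2)
    by (simp_all add: us_def)
  define p where "p = us ! j"
  have p: "p \<in> {1..d}" using sep_list_nth_mem[OF us(2), of j] us(1) j(2) by (simp add: p_def)
  have x: "arrs s ''x'' p = m p" "- M \<le> m p" "m p \<le> M"
    using s(3) p coefficient_bounds(1)[OF p] by (auto simp: abs_le_iff)
  have nth: "p = (if j < ?i then xs ! j else ys ! (j + sh))"
    using nth_crossover[OF len(1), of j] j(2) len(2) by (simp add: p_def us_def)
  have ilen: "?i \<le> length xs" by (rule crossover_point_le_length)
  have source_A: "arrs s ''A'' (Suc j) = int p" if "j < ?i"
    using xs(2) that ilen nth by (simp add: stored_def stored_prefix_def)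
  have source_B: "arrs s ''B'' (Suc (j + sh)) = int p" if "\<not> j < ?i"
    using ys(2) that j(2) len nth by (simp add: stored_def stored_prefix_def)
  have "fits w (1 + int j)" "fits w (int sh)" "fits w (1 + int j + int sh)" "fits w (int ?i)"
    "fits w (int p)" "fits w (m p)"
    using length_sep_list_le[OF xs(1) \<Delta>] length_sep_list_le[OF ys(1) \<Delta>] ilen j(2) len p x word_bounds
    unfolding fits_iff atLeastAtMost_iff by linarith+
  moreover have "nat (1 + int j) = Suc j" "nat (1 + int j + int sh) = Suc (j + sh)" by simp_all
  moreover have "set (take (Suc j) us) = insert p (set (take j us))"
    using j(2) us(1) by (simp add: take_Suc_conv_app_nth p_def)
  ultimately show ?thesis
    using s(1,2) j(1) source_A source_B x xhat
    by (auto simp: output_body_def fun_eq_iff)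
qed

lemma output_runs:
  assumes s: "ready s" "loaded s" "vars s ''sh'' = int sh"
      "vars s ''i'' = int (crossover_point \<Delta> sh xs ys)"
    and xs: "sep_list \<Delta> d xs" "stored d \<Delta> xs (arrs s ''A'')"
    and ys: "sep_list \<Delta> d ys" "stored d \<Delta> ys (arrs s ''B'')"
    and len: "length xs + sh \<le> length ys" "k = length ys - sh"
  defines "us \<equiv> crossover \<Delta> sh xs ys"
  shows "runs w output_com s (27 * d) (\<lambda>s'. arrs s' ''xhat'' = (\<lambda>p. if p \<in> set us then m p else 0))"
proof -
  let ?I = "\<lambda>j s'. arrs s' ''xhat'' = (\<lambda>p. if p \<in> set (take j us) then m p else 0)"
  have "runs w output_com s (k * (13 + 8) + 6) (?I k)"
    unfolding output_com_def
  proof (rule runs_for[where I = ?I])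
    fix j s' assume j: "j < k" "?I j s'" "vars s' ''j'' = int (Suc j)"
      and unchanged: "unchanged_outside (FOR ''j'' \<le> ''k'' DO output_body) s s'"
    have "wp w output_body (?I (Suc j)) s'"
      unfolding us_def
      by (rule output_body_wp)
        (use s xs ys len j unchanged in
          \<open>simp_all add: us_def unchanged_outside_def loaded_def output_body_def\<close>)
    then show "runs w output_body s' 13 (?I (Suc j))"
      by (rule runs_wp) (simp add: output_body_def)
  qed (use s in \<open>simp_all add: ready_def loaded_def output_body_def\<close>)
  then show ?thesis
  proof (rule runs_conseq)
    have "k \<le> d" using length_sep_list_le[OF ys(1) \<Delta>] len(2) by simp
    then show "k * (13 + 8) + 6 \<le> 27 * d" using d by simp
    show "arrs s' ''xhat'' = (\<lambda>p. if p \<in> set us then m p else 0)" if "?I k s'" for s' :: state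
      using that length_crossover[OF len(1)] len(2) by (simp add: us_def)
  qed
qed

subsection \<open>The whole program\<close>

abbreviation output_optimal :: "state \<Rightarrow> bool" where
  "output_optimal s \<equiv> max_weight_restriction d k \<Delta> m (output_array s)"

definition solved :: "int \<Rightarrow> state \<Rightarrow> bool" where
  "solved l s \<longleftrightarrow> stored d \<Delta> (relaxed_at (l + 1)) (arrs s ''A'') \<and>
     stored d \<Delta> (relaxed_at l) (arrs s ''B'') \<and> vars s ''n'' = int (length (relaxed_at l))"

lemma crossover_output_runs:
  assumes s: "ready s" "loaded s" "solved l s"
    and len: "length (relaxed_at (l + 1)) < k" "k \<le> length (relaxed_at l)"
  shows "runs w (crossover_com ;; output_com) s (61 * d) output_optimal"
proof -
  let ?xs = "relaxed_at (l + 1)" and ?ys = "relaxed_at l"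
  define sh where "sh = length ?ys - k"
  note seps = sep_list_relaxed[OF \<Delta>, of d "weight k m" "l + 1"]
    sep_list_relaxed[OF \<Delta>, of d "weight k m" l]
  have "runs w crossover_com s (34 * d)
      (\<lambda>s'. vars s' ''sh'' = int sh \<and> vars s' ''i'' = int (crossover_point \<Delta> sh ?xs ?ys))"
    using s len unfolding sh_def solved_def by (intro crossover_runs seps) simp_all
  then have "runs w (crossover_com ;; output_com) s (34 * d + 27 * d) output_optimal"
  proof (rule runs_Seq)
    fix s1 assume s1: "vars s1 ''sh'' = int sh \<and> vars s1 ''i'' = int (crossover_point \<Delta> sh ?xs ?ys)"
      and unchanged: "unchanged_outside crossover_com s s1"
    have ready: "ready s1" and loaded: "loaded s1"
      using s by (simp_all add: ready_unchanged[OF _ unchanged] loaded_unchanged[OF _ unchanged])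
    have stored: "stored d \<Delta> ?xs (arrs s1 ''A'')" "stored d \<Delta> ?ys (arrs s1 ''B'')"
      using s(3) unchanged by (simp_all add: solved_def unchanged_outside_def)
    have "is_arg_max (sum (weight k m)) (\<lambda>\<Omega>. \<Omega> \<in> sep_sets_card d k \<Delta>) (set (crossover \<Delta> sh ?xs ?ys))"
      unfolding sh_def using len by (intro max_weight_crossover_relaxed even_weight \<Delta>) simp_all
    then show "runs w output_com s1 (27 * d) output_optimal"
      using s1 len
      by (intro runs_conseq[OF output_runs[OF ready loaded _ _ seps(1) stored(1) seps(2) stored(2)]])
        (auto simp: sh_def max_weight_restriction_def output_array_def)
  qed
  then show ?thesis by simp
qed

lemma solve_both_runs:
  assumes s: "ready s" "loaded s" "bracketed l (l + 1) s"
  shows "runs w (solve_com ''hi'' ''A'' ;; solve_com ''lo'' ''B'') s (220 * d)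
    (\<lambda>s'. ready s' \<and> loaded s' \<and> solved l s')"
proof -
  have range: "in_search_range l" "in_search_range (l + 1)" "vars s ''lo'' = l" "vars s ''hi'' = l + 1"
    using s(3) by (simp_all add: bracketed_def bracket_def)
  let ?A = "\<lambda>s'. ready s' \<and> stored d \<Delta> (relaxed_at (l + 1)) (arrs s' ''A'') \<and>
    vars s' ''n'' = int (length (relaxed_at (l + 1)))"
  let ?B = "\<lambda>s'. ready s' \<and> stored d \<Delta> (relaxed_at l) (arrs s' ''B'') \<and>
    vars s' ''n'' = int (length (relaxed_at l))"
  have "runs w (solve_com ''hi'' ''A'') s (110 * d) ?A"
    using s range by (intro solve_runs) simp_all
  then have "runs w (solve_com ''hi'' ''A'' ;; solve_com ''lo'' ''B'') s (110 * d + 110 * d)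
    (\<lambda>s'. ready s' \<and> loaded s' \<and> solved l s')"
  proof (rule runs_Seq)
    fix s1 assume A: "?A s1" and unchanged: "unchanged_outside (solve_com ''hi'' ''A'') s s1"
    have s1: "loaded s1" "vars s1 ''lo'' = l"
      using s(2) range(3) unchanged by (simp_all add: loaded_def unchanged_outside_def)
    then have "runs w (solve_com ''lo'' ''B'') s1 (110 * d) ?B"
      using A range by (intro solve_runs) simp_all
    then show "runs w (solve_com ''lo'' ''B'') s1 (110 * d) (\<lambda>s'. ready s' \<and> loaded s' \<and> solved l s')"
      by (rule runs_conseq)
        (use A s1 in \<open>simp_all add: solved_def loaded_def unchanged_outside_def\<close>)
  qed
  then show ?thesis by simp
qed

lemma finish_runs:
  assumes s: "ready s" "loaded s" "solved l s" and bracket: "bracket l (l + 1)"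
  shows "runs w finish_com s (65 * d) (\<lambda>s'. sep_sets_card d k \<Delta> = {} \<or> output_optimal s')"
    (is "runs _ _ _ _ ?Q")
proof -
  let ?b = "Var ''n'' \<prec> Var ''k''"
  let ?n = "length (relaxed_at l)"
  have operands: "vars s ''n'' = int ?n" "vars s ''k'' = int k"
    using s by (simp_all add: solved_def ready_def)
  have "fits w (int ?n)"
    using length_relaxed_le[OF \<Delta>, of d "weight k m" l] word_bounds unfolding fits_iff by linarith
  then have safe: "safe_bexp w s ?b" using operands by simp
  have "runs w finish_com s (1 + bcost ?b + 61 * d) ?Q"
    unfolding finish_com_def
  proof (rule runs_Cond[OF safe])
    assume "ideal_bval s ?b"
    then have "sep_sets_card d k \<Delta> = {}" using operands bracket by (auto simp: bracket_def)
    then show "runs w Skip s (61 * d) ?Q" using d by (intro runs_wp) simp_all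
  next
    assume "\<not> ideal_bval s ?b"
    then have "length (relaxed_at (l + 1)) < k" "k \<le> ?n"
      using operands bracket by (auto simp: bracket_def)
    from crossover_output_runs[OF s this]
    show "runs w (crossover_com ;; output_com) s (61 * d) ?Q" by (rule runs_conseq) simp_all
  qed
  then show ?thesis by (rule runs_conseq) (use d in simp_all)
qed

lemma main_runs:
  assumes s: "loaded s" "vars s ''d'' = int d" "vars s ''k'' = int k" "vars s ''Delta'' = int \<Delta>"
    and N: "M * int k + M + 2 \<le> 2 ^ N"
  shows "runs w main_com s ((N + 3) * (130 * d))
    (\<lambda>s'. sep_sets_card d k \<Delta> = {} \<or> output_optimal s')" (is "runs _ _ _ _ ?Q")
proof -
  let ?ok = "\<lambda>s'. ready s' \<and> loaded s'"
  let ?started = "\<lambda>s'. ?ok s' \<and> (\<exists>l h. bracketed l h s' \<and> h - l \<le> 2 ^ N)"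
  let ?searched = "\<lambda>s'. ?ok s' \<and> (\<exists>l. bracketed l (l + 1) s')"
  let ?solved = "\<lambda>s'. ?ok s' \<and> (\<exists>l. bracket l (l + 1) \<and> solved l s')"
  have "hoare w (\<lambda>s'. s' = s) init_com (60 * d) ?started"
    using s N by (auto intro!: hoareI runs_conseq[OF init_runs])
  also have "hoare w ?started search_com (N * (130 * d) + 6) ?searched"
  proof (rule hoareI, elim conjE exE)
    fix s1 l h assume s1: "ready s1" "loaded s1" "bracketed l h s1" "h - l \<le> 2 ^ N"
    show "runs w search_com s1 (N * (130 * d) + 6) ?searched"
      by (rule runs_conseq[OF search_runs[OF s1(1,3,4)]])
        (use s1 in \<open>simp_all add: search_com_def ready_unchanged[of s1] loaded_unchanged[of s1]\<close>)
  qed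
  also have "hoare w ?searched
      (solve_com ''hi'' ''A'' ;; solve_com ''lo'' ''B'') (220 * d) ?solved"
  proof (rule hoareI, elim conjE exE)
    fix s1 l assume s1: "ready s1" "loaded s1" "bracketed l (l + 1) s1"
    show "runs w (solve_com ''hi'' ''A'' ;; solve_com ''lo'' ''B'') s1 (220 * d) ?solved"
      by (rule runs_conseq[OF solve_both_runs[OF s1]]) (use s1(3) in \<open>auto simp: bracketed_def\<close>)
  qed
  also have "hoare w ?solved finish_com (65 * d) ?Q"
    by (rule hoareI, elim conjE exE) (rule finish_runs)
  finally have "runs w main_com s (60 * d + (N * (130 * d) + 6) + 220 * d + 65 * d) ?Q"
    unfolding main_com_def by (rule hoareD) simp
  then show ?thesis by (rule runs_conseq) (use d in \<open>simp_all add: algebra_simps\<close>)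
qed

end

section \<open>Resource bounds\<close>

subsection \<open>Bit lengths\<close>

lemma bits_bounds: "0 < bits n" "\<bar>n\<bar> \<le> 2 ^ (bits n - 1)" "n < 2 ^ (bits n - 1)"
proof -
  let ?P = "\<lambda>b. 0 < b \<and> - (2 ^ (b - 1)) \<le> n \<and> n < (2 :: int) ^ (b - 1)"
  have "\<bar>n\<bar> < 2 ^ nat \<bar>n\<bar>"
    using less_exp[of "nat \<bar>n\<bar>"] by (metis abs_ge_zero int_nat_eq of_nat_less_numeral_power_cancel_iff)
  then have "?P (Suc (nat \<bar>n\<bar>))" by (simp add: abs_if split: if_splits)
  then have "?P (bits n)" unfolding bits_def by (rule LeastI)
  then show "0 < bits n" "\<bar>n\<bar> \<le> 2 ^ (bits n - 1)" "n < 2 ^ (bits n - 1)" by auto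
qed

lemma less_power_bits: "n < 2 ^ bits n"
proof -
  have "(2 :: int) ^ (bits n - 1) \<le> 2 ^ bits n" by (intro power_increasing) auto
  with bits_bounds(3)[of n] show ?thesis by linarith
qed

lemma two_le_bits:
  assumes "1 \<le> k"
  shows "2 \<le> bits (int k)"
proof (rule ccontr)
  assume "\<not> 2 \<le> bits (int k)"
  then have "bits (int k) - 1 = 0" by simp
  with bits_bounds(3)[of "int k"] assms show False by simp
qed

lemma bits_le_log:
  assumes "1 \<le> k"
  shows "real (bits (int k)) \<le> log 2 (real k) + 2"
proof -
  define b where "b = nat \<lfloor>log 2 (real k)\<rfloor>"
  have b: "int b = \<lfloor>log 2 (real k)\<rfloor>" using assms by (simp add: b_def)
  have "log 2 (real k) < real (Suc b)" using b by linarith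
  then have "real k < 2 powr real (Suc b)" using assms by (subst (asm) log_less_iff) auto
  then have "real k < 2 ^ Suc b" by (simp only: powr_realpow zero_less_numeral)
  then have "int k < 2 ^ Suc b" by (metis of_int_less_iff of_int_numeral of_int_of_nat_eq of_int_power)
  then have "bits (int k) \<le> Suc (Suc b)"
    unfolding bits_def by (intro Least_le) (auto intro: order_trans[of _ 0])
  moreover have "real b \<le> log 2 (real k)" using b by linarith
  ultimately show ?thesis by linarith
qed

subsection \<open>Word size and running time\<close>

lemma weight_le_power:
  assumes "\<bar>m i\<bar> \<le> 2 ^ (\<gamma> - 1)" "1 \<le> \<gamma>"
  shows "weight k m i \<le> 2 ^ (bits (int k) + 2 * \<gamma>)"
proof -
  let ?K = "bits (int k)"
  define P :: int where "P = 2 ^ (?K - 1 + 2 * (\<gamma> - 1))"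
  have "(m i)\<^sup>2 \<le> (2 ^ (\<gamma> - 1))\<^sup>2" using assms(1) by (simp add: abs_le_square_iff[symmetric])
  moreover have "int k + 1 \<le> 2 ^ (?K - 1)" using bits_bounds(3)[of "int k"] by linarith
  ultimately have "(int k + 1) * (m i)\<^sup>2 \<le> 2 ^ (?K - 1) * (2 ^ (\<gamma> - 1))\<^sup>2" by (intro mult_mono) auto
  also have "\<dots> = P" by (simp add: P_def power_add power_mult mult.commute flip: power_mult)
  finally have "(int k + 1) * (m i)\<^sup>2 \<le> P" .
  moreover have "1 \<le> P" by (simp add: P_def)
  ultimately have "(int k + 1) * (m i)\<^sup>2 + of_bool (m i \<noteq> 0) \<le> 2 * P" by (cases "m i = 0") simp_all
  moreover have "4 * P \<le> 2 ^ (?K + 2 * \<gamma>)"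
  proof -
    have "4 * P = 2 ^ (2 + (?K - 1 + 2 * (\<gamma> - 1)))" unfolding P_def by (simp only: power_add) simp
    also have "\<dots> \<le> 2 ^ (?K + 2 * \<gamma>)"
      using assms(2) bits_bounds(1)[of "int k"] by (intro power_increasing) auto
    finally show ?thesis .
  qed
  ultimately show ?thesis by (simp add: weight_def)
qed

lemma abs_le_max_bits:
  assumes "i \<in> {1..d}"
  shows "\<bar>m i\<bar> \<le> 2 ^ (max_bits d m - 1)"
proof -
  have "bits (m i) \<le> max_bits d m" unfolding max_bits_def using assms by (intro Max_ge) auto
  then have "(2 :: int) ^ (bits (m i) - 1) \<le> 2 ^ (max_bits d m - 1)" by (intro power_increasing) auto
  with bits_bounds(2)[of "m i"] show ?thesis by linarith
qed

lemma max_bits_pos: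
  assumes "1 \<le> d"
  shows "1 \<le> max_bits d m"
proof -
  have "bits (m 1) \<le> max_bits d m" unfolding max_bits_def using assms by (intro Max_ge) auto
  with bits_bounds(1)[of "m 1"] show ?thesis by linarith
qed

lemma search_range_le_power:
  fixes \<gamma> :: nat
  assumes "1 \<le> k"
  defines "M \<equiv> 2 ^ (bits (int k) + 2 * \<gamma>)"
  shows "M * int k + M + 2 \<le> 2 ^ (2 * bits (int k) + 2 * \<gamma>)"
proof -
  let ?K = "bits (int k)"
  have K: "2 \<le> ?K" by (rule two_le_bits[OF assms(1)])
  have "int k + 1 \<le> 2 ^ (?K - 1)" using bits_bounds(3)[of "int k"] by linarith
  then have "M * (int k + 1) \<le> M * 2 ^ (?K - 1)" by (intro mult_left_mono) (simp_all add: M_def)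
  also have "2 * (M * 2 ^ (?K - 1)) = 2 ^ (2 * ?K + 2 * \<gamma>)"
    unfolding M_def using K by (simp add: mult_2 flip: power_add power_Suc)
  finally have "2 * (M * (int k + 1)) \<le> 2 ^ (2 * ?K + 2 * \<gamma>)" by simp
  moreover have "2 \<le> M" using power_increasing[of 1 "?K + 2 * \<gamma>" "2 :: int"] K by (simp add: M_def)
  moreover have "0 \<le> M * int k" by (simp add: M_def)
  moreover have "M * (int k + 1) = M * int k + M" by (simp add: distrib_left)
  ultimately show ?thesis by linarith
qed

lemma room_less_word_size:
  fixes \<gamma> :: nat
  assumes \<gamma>: "1 \<le> \<gamma>" and k: "1 \<le> k"
  defines "M \<equiv> 2 ^ (bits (int k) + 2 * \<gamma>)"
  defines "L \<equiv> multiplier_bound k M"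
  shows "int d * (M + L) + M + 4 * L + 4 * int d + 2 * int k + 2 * int \<Delta> + 4
    < 2 ^ word_size 10 d k \<Delta> \<gamma>"
proof -
  let ?K = "bits (int k)"
  define E where "E = bits (int d) + bits (int \<Delta>) + 2 * ?K + 2 * \<gamma> + 2"
  have le_power_E: "a \<le> 2 ^ E" if "a \<le> 2 ^ n" "n \<le> E" for a :: int and n
    using order_trans[OF that(1) power_increasing[OF that(2)]] by simp
  have nonneg: "0 \<le> M" "0 \<le> M * int k" by (simp_all add: M_def)
  have "2 * (M * int k + M + 2) \<le> 2 * 2 ^ (2 * ?K + 2 * \<gamma>)"
    using search_range_le_power[OF k, of \<gamma>] unfolding M_def by (intro mult_left_mono) simp_all
  then have L: "L \<le> 2 ^ (2 * ?K + 2 * \<gamma> + 1)" "0 \<le> L"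
    using nonneg by (simp_all add: L_def multiplier_bound_def)
  have M: "M \<le> 2 ^ (2 * ?K + 2 * \<gamma> + 1)" unfolding M_def by (intro power_increasing) auto
  have "int d * (M + L) \<le> 2 ^ bits (int d) * 2 ^ (2 * ?K + 2 * \<gamma> + 2)"
    using L M nonneg less_power_bits[of "int d"] by (intro mult_mono) auto
  also have "\<dots> = 2 ^ (bits (int d) + (2 * ?K + 2 * \<gamma> + 2))" by (simp only: power_add)
  finally have "int d * (M + L) \<le> 2 ^ E" by (rule le_power_E) (simp add: E_def)
  moreover have "M \<le> 2 ^ E" "L \<le> 2 ^ E"
    by (rule le_power_E[OF M] le_power_E[OF L(1)], simp add: E_def)+
  moreover have "int d \<le> 2 ^ E" "int k \<le> 2 ^ E" "int \<Delta> \<le> 2 ^ E"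
    by (rule le_power_E[OF less_imp_le[OF less_power_bits]], simp add: E_def)+
  moreover have "(1 :: int) \<le> 2 ^ E" by simp
  ultimately have "int d * (M + L) + M + 4 * L + 4 * int d + 2 * int k + 2 * int \<Delta> + 4 \<le> 18 * 2 ^ E"
    by linarith
  also have "\<dots> < 2 ^ (5 + E)" by (simp add: power_add)
  also have "\<dots> \<le> 2 ^ word_size 10 d k \<Delta> \<gamma>"
    using \<gamma> two_le_bits[OF k] by (intro power_increasing) (auto simp: E_def word_size_def)
  finally show ?thesis .
qed

lemma projection_instance_word_size:
  assumes "1 \<le> d" "1 \<le> k" "1 \<le> \<Delta>" and \<gamma>: "\<gamma> = max_bits d m"
  shows "projection_instance (word_size 10 d k \<Delta> \<gamma>) d k \<Delta> m (2 ^ (bits (int k) + 2 * \<gamma>))"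
proof unfold_locales
  have "1 \<le> \<gamma>" unfolding \<gamma> by (rule max_bits_pos[OF assms(1)])
  fix i assume "i \<in> {1..d}"
  then have "weight k m i \<le> 2 ^ (bits (int k) + 2 * \<gamma>)"
    using \<open>1 \<le> \<gamma>\<close> unfolding \<gamma> by (intro weight_le_power abs_le_max_bits)
  moreover have "0 \<le> weight k m i" by (simp add: weight_def)
  ultimately show "0 \<le> weight k m i \<and> weight k m i \<le> 2 ^ (bits (int k) + 2 * \<gamma>)" by simp
qed (use assms room_less_word_size max_bits_pos in simp_all)

lemma steps_le_running_time:
  assumes "1 \<le> k" "1 \<le> \<gamma>" and t: "t \<le> (2 * bits (int k) + 2 * \<gamma> + 3) * (130 * d)"
  shows "real t \<le> 1170 * (real d * (real \<gamma> + log 2 (real k)) * lg d * lg \<Delta>)"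
proof -
  let ?a = "real d * (real \<gamma> + log 2 (real k))"
  have log: "0 \<le> log 2 (real k)" using assms(1) by simp
  have "real t \<le> real ((2 * bits (int k) + 2 * \<gamma> + 3) * (130 * d))" using t of_nat_mono by blast
  also have "\<dots> = (2 * real (bits (int k)) + 2 * real \<gamma> + 3) * (130 * real d)" by simp
  also have "\<dots> \<le> (9 * (real \<gamma> + log 2 (real k))) * (130 * real d)"
    using bits_le_log[OF assms(1)] assms(2) log by (intro mult_right_mono) auto
  also have "\<dots> = 1170 * ?a" by simp
  also have "\<dots> \<le> 1170 * (?a * lg d * lg \<Delta>)"
  proof -
    have "1 * 1 \<le> lg d * lg \<Delta>" by (intro mult_mono) (auto simp: lg_def)
    moreover have "0 \<le> ?a" using log by simp
    ultimately have "?a * 1 \<le> ?a * (lg d * lg \<Delta>)" by (intro mult_left_mono) simp_all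
    then show ?thesis by (simp add: mult.assoc)
  qed
  finally show ?thesis .
qed

lemma main_com_within_time:
  assumes d: "1 \<le> d" and k: "1 \<le> k" and \<Delta>: "1 \<le> \<Delta>" and \<gamma>: "\<gamma> = max_bits d m"
  obtains t s where "exec (word_size 10 d k \<Delta> \<gamma>) main_com (input_state d k \<Delta> m) t s"
    "real t \<le> 1170 * (real d * (real \<gamma> + log 2 (real k)) * lg d * lg \<Delta>)"
    "sep_sets_card d k \<Delta> = {} \<or> max_weight_restriction d k \<Delta> m (output_array s)"
proof -
  interpret projection_instance "word_size 10 d k \<Delta> \<gamma>" d k \<Delta> m "2 ^ (bits (int k) + 2 * \<gamma>)"
    by (rule projection_instance_word_size[OF assms])
  have "runs (word_size 10 d k \<Delta> \<gamma>) main_com (input_state d k \<Delta> m)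
      ((2 * bits (int k) + 2 * \<gamma> + 3) * (130 * d))
      (\<lambda>s. sep_sets_card d k \<Delta> = {} \<or> output_optimal s)"
    using search_range_le_power[OF k, of \<gamma>] by (intro main_runs) (auto simp: loaded_def input_state_def)
  then obtain t s where "exec (word_size 10 d k \<Delta> \<gamma>) main_com (input_state d k \<Delta> m) t s"
    and "t \<le> (2 * bits (int k) + 2 * \<gamma> + 3) * (130 * d)"
    and "sep_sets_card d k \<Delta> = {} \<or> output_optimal s" by (auto simp: runs_def)
  then show ?thesis
    using steps_le_running_time[OF k] max_bits_pos[OF d, of m] \<gamma> by (intro that) auto
qed

theorem theorem2:
  "\<exists>(prog :: com) (c :: nat) (C :: real).
     \<forall>(d :: nat) (k :: nat) (\<Delta> :: nat) (\<gamma> :: nat) (x :: nat \<Rightarrow> real) (m :: nat \<Rightarrow> int) (e :: int).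
       d \<ge> 1 \<and> k \<ge> 1 \<and> \<Delta> \<ge> 1 \<and> (\<forall>i\<in>{1..d}. x i = decode e m i) \<and> \<gamma> = max_bits d m \<longrightarrow>
       (\<exists>t s xhat.
          exec (word_size c d k \<Delta> \<gamma>) prog (input_state d k \<Delta> m) t s \<and>
          real t \<le> C * (real d * (real \<gamma> + log 2 (real k)) * lg d * lg \<Delta>) \<and>
          xhat = decode e (output_array s) \<and>
          ((\<exists>z. is_arg_min (l2_dist d x) (\<lambda>x'. supp d x' \<in> sep_sets_card d k \<Delta>) z) \<longrightarrow>
             is_arg_min (l2_dist d x) (\<lambda>x'. supp d x' \<in> sep_sets_card d k \<Delta>) xhat) \<and>
          ((\<exists>z. is_arg_min (l2_dist d x) (\<lambda>x'. \<exists>\<Omega>\<in>sep_sets_card d k \<Delta>. supp d x' \<subseteq> \<Omega>) z) \<longrightarrow>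
             is_arg_min (l2_dist d x) (\<lambda>x'. \<exists>\<Omega>\<in>sep_sets_card d k \<Delta>. supp d x' \<subseteq> \<Omega>) xhat))"
proof (rule exI[of _ main_com], rule exI[of _ 10], rule exI[of _ 1170], intro allI impI, elim conjE)
  fix d k \<Delta> \<gamma> :: nat and x :: "nat \<Rightarrow> real" and m :: "nat \<Rightarrow> int" and e :: int
  assume d: "1 \<le> d" and k: "1 \<le> k" and \<Delta>: "1 \<le> \<Delta>" and \<gamma>: "\<gamma> = max_bits d m"
    and x: "\<forall>i\<in>{1..d}. x i = decode e m i"
  obtain t s where run: "exec (word_size 10 d k \<Delta> \<gamma>) main_com (input_state d k \<Delta> m) t s"
      "real t \<le> 1170 * (real d * (real \<gamma> + log 2 (real k)) * lg d * lg \<Delta>)"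
    and result: "sep_sets_card d k \<Delta> = {} \<or> max_weight_restriction d k \<Delta> m (output_array s)"
    by (rule main_com_within_time[OF d k \<Delta> \<gamma>])
  let ?exact = "is_arg_min (l2_dist d x) (\<lambda>x'. supp d x' \<in> sep_sets_card d k \<Delta>)"
    and ?subset = "is_arg_min (l2_dist d x) (\<lambda>x'. \<exists>\<Omega>\<in>sep_sets_card d k \<Delta>. supp d x' \<subseteq> \<Omega>)"
  from run arg_min_decode_if_solvable[OF bspec[OF x] result]
  show "\<exists>t s xhat.
      exec (word_size 10 d k \<Delta> \<gamma>) main_com (input_state d k \<Delta> m) t s \<and>
      real t \<le> 1170 * (real d * (real \<gamma> + log 2 (real k)) * lg d * lg \<Delta>) \<and>
      xhat = decode e (output_array s) \<and>
      ((\<exists>z. ?exact z) \<longrightarrow> ?exact xhat) \<and> ((\<exists>z. ?subset z) \<longrightarrow> ?subset xhat)"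
    by (intro exI[of _ t] exI[of _ s]) simp
qed

end
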